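(* Let $R$ be a DT ring with $2\in\Delta(R)$, and let $G$ be a locally finite $2$-group. Then the group ring $RG$ is a DT ring.
   Context: All rings are associative with identity; $U(R)$ is the group of units. $\Delta(R)=\{x\in R: x+u\in U(R)\text{ for all }u\in U(R)\}$. $\mathrm{Tr}(R)=\{x\in R: x^3=x\}$. A ring $R$ is a DT ring if every $r\in R$ can be written $r=e+d$ with $e\in\mathrm{Tr}(R)$ and $d\in\Delta(R)$. A group is locally finite if every finitely generated subgroup is finite. $RG$ denotes the group ring. *)

theory Defs
  imports "HOL-Algebra.Multiplicative_Group" "HOL-Algebra.Generated_Groups"
begin

definition Delta :: "('a, 'b) ring_scheme \<Rightarrow> 'a set" where
  "Delta R = {x \<in> carrier R. \<forall>u \<in> Units R. x \<oplus>\<^bsub>R\<^esub> u \<in> Units R}"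

definition Tr :: "('a, 'b) ring_scheme \<Rightarrow> 'a set" where
  "Tr R = {x \<in> carrier R. x [^]\<^bsub>R\<^esub> (3::nat) = x}"

definition DT_ring :: "('a, 'b) ring_scheme \<Rightarrow> bool" where
  "DT_ring R \<longleftrightarrow> ring R \<and>
     (\<forall>r \<in> carrier R. \<exists>e \<in> Tr R. \<exists>d \<in> Delta R. r = e \<oplus>\<^bsub>R\<^esub> d)"

definition locally_finite_group :: "('g, 'c) monoid_scheme \<Rightarrow> bool" where
  "locally_finite_group G \<longleftrightarrow>
     (\<forall>S. S \<subseteq> carrier G \<and> finite S \<longrightarrow> finite (generate G S))"

(* 2-group: every element has order a power of 2 (infinite order gives ord = 0) *)
definition two_group :: "('g, 'c) monoid_scheme \<Rightarrow> bool" where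
  "two_group G \<longleftrightarrow> group G \<and> (\<forall>g \<in> carrier G. \<exists>n::nat. group.ord G g = 2 ^ n)"

definition supp_gr :: "('a, 'b) ring_scheme \<Rightarrow> ('g, 'c) monoid_scheme \<Rightarrow> ('g \<Rightarrow> 'a) \<Rightarrow> 'g set" where
  "supp_gr R G f = {g \<in> carrier G. f g \<noteq> \<zero>\<^bsub>R\<^esub>}"

definition gr_carrier :: "('a, 'b) ring_scheme \<Rightarrow> ('g, 'c) monoid_scheme \<Rightarrow> ('g \<Rightarrow> 'a) set" where
  "gr_carrier R G = {f. f \<in> carrier G \<rightarrow>\<^sub>E carrier R \<and> finite (supp_gr R G f)}"

definition gr_mult :: "('a, 'b) ring_scheme \<Rightarrow> ('g, 'c) monoid_scheme \<Rightarrow> ('g \<Rightarrow> 'a) \<Rightarrow> ('g \<Rightarrow> 'a) \<Rightarrow> ('g \<Rightarrow> 'a)" where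
  "gr_mult R G f h = (\<lambda>x \<in> carrier G.
      \<Oplus>\<^bsub>R\<^esub> y \<in> supp_gr R G f. f y \<otimes>\<^bsub>R\<^esub> h (inv\<^bsub>G\<^esub> y \<otimes>\<^bsub>G\<^esub> x))"

definition gr_one :: "('a, 'b) ring_scheme \<Rightarrow> ('g, 'c) monoid_scheme \<Rightarrow> ('g \<Rightarrow> 'a)" where
  "gr_one R G = (\<lambda>x \<in> carrier G. if x = \<one>\<^bsub>G\<^esub> then \<one>\<^bsub>R\<^esub> else \<zero>\<^bsub>R\<^esub>)"

definition gr_zero :: "('a, 'b) ring_scheme \<Rightarrow> ('g, 'c) monoid_scheme \<Rightarrow> ('g \<Rightarrow> 'a)" where
  "gr_zero R G = (\<lambda>x \<in> carrier G. \<zero>\<^bsub>R\<^esub>)"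

definition gr_add :: "('a, 'b) ring_scheme \<Rightarrow> ('g, 'c) monoid_scheme \<Rightarrow> ('g \<Rightarrow> 'a) \<Rightarrow> ('g \<Rightarrow> 'a) \<Rightarrow> ('g \<Rightarrow> 'a)" where
  "gr_add R G f h = (\<lambda>x \<in> carrier G. f x \<oplus>\<^bsub>R\<^esub> h x)"

definition group_ring :: "('a, 'b) ring_scheme \<Rightarrow> ('g, 'c) monoid_scheme \<Rightarrow> ('g \<Rightarrow> 'a) ring" where
  "group_ring R G = \<lparr>carrier = gr_carrier R G, mult = gr_mult R G, one = gr_one R G,
      zero = gr_zero R G, add = gr_add R G\<rparr>"

end

(* Let S = RG, aug : S -> R the augmentation and I its kernel. Since R is a subring of S and aug a
   retraction onto it, it suffices that aug detects units: then r = aug r + (r - aug r), and if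
   aug r = e + d is a DT decomposition in R, then d + (r - aug r) lies in Delta(S).

   First, 1 + 2r is a unit of R for every r: for a tripotent e the element 1 - 2e^2 is an
   involution, so 1 + 2e^2 = 2 - (1 - 2e^2) is a unit, hence so is
   (1 - 2e^2)(1 + 2e^2) = (1 - 2e)(1 + 2e); writing r = e + d, add d twice. By a Nakayama argument
   over finite subgroups, 1 + 2s is then a unit of S for every s in S.

   An element x of I lies in the group ring of a finite 2-group H. By counting fixed points, the
   augmentation ideal of H is nilpotent modulo 2, so x^n lies in 2S for some n, and 1 - x is a unit
   because it divides 1 - x^(2^n). *)

theory Submission
  imports Defs "HOL-Algebra.Group_Action" "HOL-Algebra.Sylow"
begin

section \<open>Units in rings\<close>

text \<open>\<open>Delta R\<close> is closed under addition but need not be an ideal, so 2 in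
  \<open>Delta R\<close> does not by itself put 2r there; the tripotent decomposition of r bridges
  this gap. Since 2 is central, the outcome says that 2 lies in the Jacobson radical of R. Carrying
  this over to S is a question about the group ring of a finite subgroup, a finitely generated
  module over R. As R may be noncommutative, no determinant is available: generators are eliminated
  one by one, which gives inverses on one side only, and the other side has to be recovered
  afterwards. The nilpotency is really a fact about the group algebra of H over the field with two
  elements. Two devices replace quotient rings: elements of that algebra are subsets of H with
  symmetric difference as addition, and congruence modulo 2S is built into a chain of subsets of S
  whose lowest stage is 2S. Passing from a subset to its indicator function is additive only up to
  2S, which such a chain absorbs.\<close>

context ring
begin

lemma Units_minus:
  assumes "u \<in> Units R" shows "\<ominus> u \<in> Units R"
proof -
  have u: "u \<in> carrier R" "inv u \<in> carrier R" using assms by auto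
  have "(\<ominus> (inv u)) \<otimes> (\<ominus> u) = \<one>" "(\<ominus> u) \<otimes> (\<ominus> (inv u)) = \<one>"
    using assms u by (simp_all add: l_minus r_minus)
  then show ?thesis unfolding Units_def using u by blast
qed

text \<open>In a noncommutative ring an invertible product makes \<open>x\<close> invertible on the
  right only. Commutation turns \<open>?w \<otimes> y\<close> into a left inverse, and one-sided
  inverses on both sides coincide.\<close>

lemma Units_of_commuting_mult:
  assumes "x \<in> carrier R" "y \<in> carrier R" "x \<otimes> y \<in> Units R" "x \<otimes> y = y \<otimes> x"
  shows "x \<in> Units R"
proof -
  let ?w = "inv (x \<otimes> y)"
  have w: "?w \<in> carrier R" using assms by auto
  have r: "x \<otimes> (y \<otimes> ?w) = \<one>" using assms w by (simp flip: m_assoc)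
  have l: "(?w \<otimes> y) \<otimes> x = \<one>" using assms w Units_l_inv[OF assms(3)] by (simp only: m_assoc assms(4))
  have "?w \<otimes> y = y \<otimes> ?w" using inv_unique[OF l r] assms w by simp
  then show ?thesis using r l assms w unfolding Units_def by auto
qed

lemma Delta_Units: "d \<in> Delta R \<Longrightarrow> u \<in> Units R \<Longrightarrow> d \<oplus> u \<in> Units R"
  by (simp add: Delta_def)

lemma one_plus_double_Units:
  assumes dt: "DT_ring R" and two: "\<one> \<oplus> \<one> \<in> Delta R" and r: "r \<in> carrier R"
  shows "\<one> \<oplus> (r \<oplus> r) \<in> Units R"
proof -
  obtain e d where e: "e \<in> Tr R" and d: "d \<in> Delta R" and red: "r = e \<oplus> d"
    using dt r unfolding DT_ring_def by blast
  have ec: "e \<in> carrier R" and e3: "e \<otimes> e \<otimes> e = e"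
    using e by (auto simp: Tr_def numeral_3_eq_3)
  have dc: "d \<in> carrier R" using d by (simp add: Delta_def)
  \<comment> \<open>An idempotent, as e^4 = e^2. This makes 1 - 2q an involution and collapses both
    (1 - 2q)(1 + 2q) and (1 - 2e)(1 + 2e) to 1 - 4q.\<close>
  define q where "q = e \<otimes> e"
  have qc: "q \<in> carrier R" using ec by (simp add: q_def)
  have qe: "q \<otimes> e = e" "e \<otimes> q = e" using e3 ec by (simp_all add: q_def m_assoc)
  have qq: "q \<otimes> q = q" using qe ec by (simp add: q_def flip: m_assoc)
  have ee: "e \<otimes> e = q" by (simp add: q_def)
  define b where "b = \<one> \<ominus> (q \<oplus> q)"
  have bc: "b \<in> carrier R" using qc by (simp add: b_def)
  have "b \<otimes> b = \<one>"
    unfolding b_def using qc qq by (simp add: minus_eq r_distr l_distr l_minus r_minus) algebra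
  then have bU: "b \<in> Units R" using bc unfolding Units_def by blast
  have "(\<one> \<oplus> \<one>) \<oplus> \<ominus> b \<in> Units R" by (rule Delta_Units[OF two Units_minus[OF bU]])
  also have "(\<one> \<oplus> \<one>) \<oplus> \<ominus> b = \<one> \<oplus> (q \<oplus> q)" unfolding b_def using qc by algebra
  finally have "b \<otimes> (\<one> \<oplus> (q \<oplus> q)) \<in> Units R" using bU by simp
  also have "b \<otimes> (\<one> \<oplus> (q \<oplus> q)) = \<one> \<ominus> (q \<oplus> q \<oplus> q \<oplus> q)"
    unfolding b_def using qc qq by (simp add: minus_eq r_distr l_distr l_minus r_minus) algebra
  finally have U: "\<one> \<ominus> (q \<oplus> q \<oplus> q \<oplus> q) \<in> Units R" .
  have xy: "(\<one> \<oplus> (e \<oplus> e)) \<otimes> (\<one> \<ominus> (e \<oplus> e)) = \<one> \<ominus> (q \<oplus> q \<oplus> q \<oplus> q)"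
    using qc ec ee by (simp add: minus_eq r_distr l_distr l_minus r_minus) algebra
  have yx: "(\<one> \<ominus> (e \<oplus> e)) \<otimes> (\<one> \<oplus> (e \<oplus> e)) = \<one> \<ominus> (q \<oplus> q \<oplus> q \<oplus> q)"
    using qc ec ee by (simp add: minus_eq r_distr l_distr l_minus r_minus) algebra
  have "\<one> \<oplus> (e \<oplus> e) \<in> carrier R" "\<one> \<ominus> (e \<oplus> e) \<in> carrier R" using ec by simp_all
  from Units_of_commuting_mult[OF this, unfolded xy yx, OF U refl]
  have "\<one> \<oplus> (e \<oplus> e) \<in> Units R" .
  then have "d \<oplus> (d \<oplus> (\<one> \<oplus> (e \<oplus> e))) \<in> Units R" by (intro Delta_Units[OF d])
  also have "d \<oplus> (d \<oplus> (\<one> \<oplus> (e \<oplus> e))) = \<one> \<oplus> (r \<oplus> r)"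
    unfolding red using ec dc by algebra
  finally show ?thesis .
qed

end

text \<open>Descent along 1 - z^2 = (1 - z)(1 + z) with commuting factors. Exponents that are powers
  of two need only this factorisation, not a geometric sum.\<close>

lemma (in ring) Units_one_minus_pow2:
  assumes "x \<in> carrier R" "\<one> \<ominus> x [^] (2 ^ j :: nat) \<in> Units R"
  shows "\<one> \<ominus> x \<in> Units R"
  using assms(2)
proof (induction j)
  case (Suc j)
  define z where "z = x [^] (2 ^ j :: nat)"
  have z: "z \<in> carrier R" using assms(1) by (simp add: z_def)
  have "x [^] (2 ^ Suc j :: nat) = z \<otimes> z"
    using assms(1) by (simp add: z_def nat_pow_mult mult_2)
  then have U: "\<one> \<ominus> z \<otimes> z \<in> Units R" using Suc.prems by simp
  have xy: "(\<one> \<ominus> z) \<otimes> (\<one> \<oplus> z) = \<one> \<ominus> z \<otimes> z"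
    using z by (simp add: minus_eq r_distr l_distr l_minus r_minus) algebra
  have yx: "(\<one> \<oplus> z) \<otimes> (\<one> \<ominus> z) = \<one> \<ominus> z \<otimes> z"
    using z by (simp add: minus_eq r_distr l_distr l_minus r_minus) algebra
  have "\<one> \<ominus> z \<in> carrier R" "\<one> \<oplus> z \<in> carrier R" using z by simp_all
  from Units_of_commuting_mult[OF this, unfolded xy yx, OF U refl]
  show ?case using Suc.IH by (simp add: z_def)
qed (use assms(1) in simp)

lemma (in abelian_monoid) finsum_swap:
  assumes "finite A" "finite B" "\<And>a b. a \<in> A \<Longrightarrow> b \<in> B \<Longrightarrow> f a b \<in> carrier G"
  shows "(\<Oplus>a\<in>A. \<Oplus>b\<in>B. f a b) = (\<Oplus>b\<in>B. \<Oplus>a\<in>A. f a b)"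
  using assms(1,3)
proof (induction A rule: finite_induct)
  case (insert x A)
  have "(\<Oplus>a\<in>insert x A. \<Oplus>b\<in>B. f a b) = (\<Oplus>b\<in>B. f x b) \<oplus> (\<Oplus>b\<in>B. \<Oplus>a\<in>A. f a b)"
    using insert by (subst finsum_insert) auto
  also have "\<dots> = (\<Oplus>b\<in>B. f x b \<oplus> (\<Oplus>a\<in>A. f a b))"
    using insert by (subst finsum_addf) auto
  also have "\<dots> = (\<Oplus>b\<in>B. \<Oplus>a\<in>insert x A. f a b)"
    using insert by (intro finsum_cong' refl) auto
  finally show ?case .
qed simp

section \<open>Actions of finite 2-groups\<close>

text \<open>Elements of \<open>BijGroup E\<close> are extensional, hence the restriction of
  \<open>a g\<close> to \<open>E\<close>. Bijectivity comes from the action of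
  \<open>inv g\<close>.\<close>

lemma group_actionI:
  fixes G (structure)
  assumes "group G"
    and closed: "\<And>g x. g \<in> carrier G \<Longrightarrow> x \<in> E \<Longrightarrow> a g x \<in> E"
    and one: "\<And>x. x \<in> E \<Longrightarrow> a \<one> x = x"
    and mult: "\<And>g h x. g \<in> carrier G \<Longrightarrow> h \<in> carrier G \<Longrightarrow> x \<in> E \<Longrightarrow> a (g \<otimes> h) x = a g (a h x)"
  shows "group_action G E (\<lambda>g. \<lambda>x\<in>E. a g x)"
proof -
  interpret group G by fact
  have bij: "(\<lambda>x\<in>E. a g x) \<in> Bij E" if g: "g \<in> carrier G" for g
  proof -
    have "bij_betw (\<lambda>x\<in>E. a g x) E E"
      by (rule bij_betw_byWitness[where f' = "a (inv g)"])
         (use g closed in \<open>auto simp flip: mult simp: one\<close>)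
    then show ?thesis by (simp add: Bij_def)
  qed
  have "(\<lambda>g. \<lambda>x\<in>E. a g x) \<in> hom G (BijGroup E)"
  proof (rule homI)
    fix g h assume gh: "g \<in> carrier G" "h \<in> carrier G"
    have "(\<lambda>x\<in>E. a (g \<otimes> h) x) = compose E (\<lambda>x\<in>E. a g x) (\<lambda>x\<in>E. a h x)"
      using gh closed by (auto simp: compose_def mult)
    then show "(\<lambda>x\<in>E. a (g \<otimes> h) x) = (\<lambda>x\<in>E. a g x) \<otimes>\<^bsub>BijGroup E\<^esub> (\<lambda>x\<in>E. a h x)"
      using bij gh by (simp add: BijGroup_def)
  qed (use bij in \<open>simp add: BijGroup_def\<close>)
  then show ?thesis
    by (intro group_action.intro group_hom.intro group_hom_axioms.intro group_BijGroup assms(1))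
qed

text \<open>Orbit sizes divide a power of two, so an orbit of odd size is a fixed point. Were
  \<open>x\<close> the only one, \<open>card E\<close> would be 1 plus a sum of even
  numbers.\<close>

lemma (in group_action) two_group_second_fixed_point:
  assumes ord: "order G = 2 ^ k" and fin: "finite E" and even: "even (card E)"
    and x: "x \<in> E" and fixed: "\<And>g. g \<in> carrier G \<Longrightarrow> \<phi> g x = x"
  shows "\<exists>y\<in>E. y \<noteq> x \<and> (\<forall>g\<in>carrier G. \<phi> g y = y)"
proof (rule ccontr)
  assume no: "\<not> ?thesis"
  interpret group_hom G "BijGroup E" \<phi> by (rule group_hom)
  have xo: "orbit G \<phi> x = {x}" using fixed group.is_monoid[OF G.is_group] by (force simp: orbit_def)
  have xorb: "{x} \<in> orbits G E \<phi>" using x xo by (auto simp: orbits_def)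
  have fo: "finite (orbits G E \<phi>)"
    using fin orbits_coverture finite_UnionD by metis
  have "even (card ob)" if ob: "ob \<in> orbits G E \<phi> - {{x}}" for ob
  proof (rule ccontr)
    assume odd: "odd (card ob)"
    obtain y where y: "y \<in> E" "ob = orbit G \<phi> y" using ob by (auto simp: orbits_def)
    have "card ob dvd 2 ^ k" using orbit_stabilizer_theorem[OF y(1)] ord y(2) by (metis dvd_triv_left)
    then obtain j where "card ob = 2 ^ j" using divides_primepow_nat two_is_prime_nat by blast
    then have "card ob = 1" using odd by (cases j) auto
    moreover have "y \<in> ob" using orbit_refl y by blast
    ultimately have "ob = {y}" by (auto simp: card_1_singleton_iff)
    moreover from this have "\<forall>g\<in>carrier G. \<phi> g y = y" using y(2) by (auto simp: orbit_def)
    then have "y = x" using no y(1) by blast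
    ultimately show False using ob by simp
  qed
  then have "even (\<Sum>ob\<in>orbits G E \<phi> - {{x}}. card ob)" by (rule dvd_sum)
  moreover have "card E = (\<Sum>ob\<in>orbits G E \<phi>. card ob)"
    using disjoint_sum[OF fin, of "\<lambda>_. 1::nat"] by simp
  moreover have "\<dots> = card {x} + (\<Sum>ob\<in>orbits G E \<phi> - {{x}}. card ob)"
    using sum.remove[OF fo xorb] by blast
  ultimately show False using even by simp
qed

text \<open>\<open>G\<close> permutes the right cosets of \<open>F\<close>, and \<open>F\<close>
  itself is a fixed coset. The index of a proper subgroup of a group of order 2^m is even, so there
  is a second fixed coset; any representative of it is moved by \<open>G\<close> only within that
  coset.\<close>

lemma two_group_fixed_coset:
  fixes G (structure) and V :: "('v, 'w) monoid_scheme"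
  assumes G: "group G" "order G = 2 ^ k" and V: "group V" "order V = 2 ^ m"
    and F: "subgroup F V" "F \<noteq> carrier V"
    and hom: "\<And>g. g \<in> carrier G \<Longrightarrow> a g \<in> hom V V"
    and one: "\<And>x. x \<in> carrier V \<Longrightarrow> a \<one> x = x"
    and mult: "\<And>g h x. g \<in> carrier G \<Longrightarrow> h \<in> carrier G \<Longrightarrow> x \<in> carrier V \<Longrightarrow> a (g \<otimes> h) x = a g (a h x)"
    and stable: "\<And>g x. g \<in> carrier G \<Longrightarrow> x \<in> F \<Longrightarrow> a g x \<in> F"
  shows "\<exists>x\<in>carrier V - F. \<forall>g\<in>carrier G. a g x \<otimes>\<^bsub>V\<^esub> inv\<^bsub>V\<^esub> x \<in> F"
proof -
  interpret G: group G by fact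
  interpret V: group V by fact
  interpret F: subgroup F V by fact
  let ?E = "rcosets\<^bsub>V\<^esub> F"
  \<comment> \<open>Stability gives one inclusion and the inverse group element the other; equality
    is what makes the image of a coset a whole coset.\<close>
  have img: "a g ` F = F" if g: "g \<in> carrier G" for g
  proof
    show "a g ` F \<subseteq> F" using stable g by blast
    have "x \<in> a g ` F" if "x \<in> F" for x
    proof -
      have "x = a g (a (inv g) x)" using g that by (simp flip: mult add: one F.mem_carrier)
      then show ?thesis using stable[of "inv g" x] g that by blast
    qed
    then show "F \<subseteq> a g ` F" by blast
  qed
  have act: "a g ` (F #>\<^bsub>V\<^esub> x) = F #>\<^bsub>V\<^esub> a g x" if "g \<in> carrier G" "x \<in> carrier V" for g x
  proof -
    have "a g ` (F #>\<^bsub>V\<^esub> x) = a g ` F #>\<^bsub>V\<^esub> a g x"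
      using that F.mem_carrier hom_mult[OF hom[OF that(1)]]
      unfolding r_coset_def by (auto 0 4 simp: image_iff)
    then show ?thesis using img that by simp
  qed
  have hc: "a g x \<in> carrier V" if "g \<in> carrier G" "x \<in> carrier V" for g x
    using hom[OF that(1)] that(2) by (auto simp: hom_def)
  interpret A: group_action G ?E "\<lambda>g. \<lambda>C\<in>?E. a g ` C"
  proof (rule group_actionI[OF G(1)])
    fix g C assume g: "g \<in> carrier G" and C: "C \<in> ?E"
    show "a g ` C \<in> ?E" using C hc[OF g] act[OF g] unfolding RCOSETS_def by fastforce
  next
    fix C assume C: "C \<in> ?E"
    then have "C \<subseteq> carrier V" using V.rcosets_part_G[OF F(1)] by blast
    then have "\<And>x. x \<in> C \<Longrightarrow> a \<one> x = x" using one by blast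
    then show "a \<one> ` C = C" by simp
  next
    fix g h C assume gh: "g \<in> carrier G" "h \<in> carrier G" and C: "C \<in> ?E"
    have "C \<subseteq> carrier V" using C V.rcosets_part_G[OF F(1)] by blast
    then have "\<And>x. x \<in> C \<Longrightarrow> a (g \<otimes> h) x = a g (a h x)" using mult[OF gh] by blast
    then show "a (g \<otimes> h) ` C = a g ` a h ` C" by (simp add: image_image)
  qed
  have lag: "card ?E * card F = 2 ^ m" using V.lagrange[OF F(1)] V(2) by simp
  have FE: "F \<in> ?E" 
    using V.rcosetsI[OF F.subset V.one_closed] V.coset_mult_one[OF F.subset] by simp
  have finE: "finite ?E" using lag by (intro card_ge_0_finite gr0I) simp
  have ne1: "card ?E \<noteq> 1"
  proof
    assume "card ?E = 1"
    then have "?E = {F}" using FE by (auto simp: card_1_singleton_iff)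
    then have "carrier V = F" using V.rcosets_part_G[OF F(1)] by simp
    then show False using F(2) by simp
  qed
  have "card ?E dvd 2 ^ m" using lag by (metis dvd_triv_left)
  then obtain j where j: "card ?E = 2 ^ j" using divides_primepow_nat two_is_prime_nat by blast
  with ne1 have ev: "even (card ?E)" by (cases j) auto
  have "(\<lambda>C\<in>?E. a g ` C) F = F" if "g \<in> carrier G" for g
    using FE img[OF that] by simp
  then obtain C where C: "C \<in> ?E" "C \<noteq> F" "\<forall>g\<in>carrier G. (\<lambda>C\<in>?E. a g ` C) C = C"
    using A.two_group_second_fixed_point[OF G(2) finE ev FE] by blast
  have Cfix: "a g ` C = C" if "g \<in> carrier G" for g
    using C(1) C(3)[rule_format, OF that] by simp
  obtain x where x: "x \<in> carrier V" "C = F #>\<^bsub>V\<^esub> x" using C(1) by (auto simp: RCOSETS_def)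
  have "x \<notin> F" using C(2) x V.coset_join2[OF x(1) F(1)] by auto
  moreover have "a g x \<otimes>\<^bsub>V\<^esub> inv\<^bsub>V\<^esub> x \<in> F" if g: "g \<in> carrier G" for g
  proof -
    have "a g x \<in> F #>\<^bsub>V\<^esub> x"
      using act[OF g x(1)] Cfix[OF g] x hc[OF g x(1)] V.rcos_self[OF _ F(1)] by metis
    then obtain f where f: "f \<in> F" "a g x = f \<otimes>\<^bsub>V\<^esub> x" by (auto simp: r_coset_def)
    then show ?thesis using x(1) by (simp add: V.m_assoc F.mem_carrier)
  qed
  ultimately show ?thesis using x(1) by blast
qed

section \<open>Subsets of a group as its group algebra over the field with two elements\<close>

abbreviation symdiff :: "'a set \<Rightarrow> 'a set \<Rightarrow> 'a set" where
  "symdiff X Y \<equiv> (X - Y) \<union> (Y - X)"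

text \<open>The additive group of all functions from \<open>A\<close> to the field with two
  elements, each written as its support. Every element is its own inverse.\<close>

definition symdiff_group :: "'a set \<Rightarrow> 'a set monoid" where
  "symdiff_group A = \<lparr>carrier = Pow A, monoid.mult = symdiff, one = {}\<rparr>"

lemma group_symdiff_group: "group (symdiff_group A)"
proof (rule groupI)
  fix X assume "X \<in> carrier (symdiff_group A)"
  then show "\<exists>Y\<in>carrier (symdiff_group A). Y \<otimes>\<^bsub>symdiff_group A\<^esub> X = \<one>\<^bsub>symdiff_group A\<^esub>"
    by (auto simp: symdiff_group_def)
qed (auto simp: symdiff_group_def)

lemma inv_symdiff_group: "X \<subseteq> A \<Longrightarrow> inv\<^bsub>symdiff_group A\<^esub> X = X"
  by (rule group.inv_equality[OF group_symdiff_group]) (auto simp: symdiff_group_def)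

text \<open>The upper annihilator series. With subsets read as functions modulo 2, the symmetric
  difference of the translate of \<open>X\<close> by g and \<open>X\<close> is (g - 1)X, so stage i
  consists of the elements killed by every product of i factors g - 1.\<close>

primrec flag :: "('g, 'c) monoid_scheme \<Rightarrow> nat \<Rightarrow> 'g set set" where
  "flag G 0 = {{}}"
| "flag G (Suc i) = {X. X \<subseteq> carrier G \<and>
      (\<forall>g\<in>carrier G. symdiff ((\<lambda>x. g \<otimes>\<^bsub>G\<^esub> x) ` X) X \<in> flag G i)}"

context group
begin

lemma translate_symdiff:
  assumes "g \<in> carrier G" "X \<subseteq> carrier G" "Y \<subseteq> carrier G"
  shows "(\<lambda>x. g \<otimes> x) ` symdiff X Y = symdiff ((\<lambda>x. g \<otimes> x) ` X) ((\<lambda>x. g \<otimes> x) ` Y)"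
proof -
  have "(\<lambda>x. g \<otimes> x) ` (A - B) = (\<lambda>x. g \<otimes> x) ` A - (\<lambda>x. g \<otimes> x) ` B"
    if "A \<subseteq> carrier G" "B \<subseteq> carrier G" for A B
    using that by (intro inj_on_image_set_diff[OF inj_on_cmult[OF assms(1)]]) auto
  then show ?thesis using assms by (simp add: image_Un)
qed

lemma flag_subset: "flag G i \<subseteq> Pow (carrier G)"
  by (cases i) auto

lemma flag_empty: "{} \<in> flag G i"
  by (induction i) auto

lemma flag_symdiff: "X \<in> flag G i \<Longrightarrow> Y \<in> flag G i \<Longrightarrow> symdiff X Y \<in> flag G i"
proof (induction i arbitrary: X Y)
  case (Suc i)
  have "symdiff ((\<lambda>x. g \<otimes> x) ` symdiff X Y) (symdiff X Y) \<in> flag G i" if g: "g \<in> carrier G" for g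
  proof -
    have tr: "(\<lambda>x. g \<otimes> x) ` symdiff X Y = symdiff ((\<lambda>x. g \<otimes> x) ` X) ((\<lambda>x. g \<otimes> x) ` Y)"
      by (rule translate_symdiff) (use Suc.prems g in simp_all)
    have "symdiff ((\<lambda>x. g \<otimes> x) ` symdiff X Y) (symdiff X Y)
        = symdiff (symdiff ((\<lambda>x. g \<otimes> x) ` X) X) (symdiff ((\<lambda>x. g \<otimes> x) ` Y) Y)"
      unfolding tr by blast
    also have "\<dots> \<in> flag G i"
      by (rule Suc.IH) (use Suc.prems g in simp_all)
    finally show ?thesis .
  qed
  then show ?case using Suc.prems by auto
qed simp

text \<open>Stability at a stage follows from growth below it: the translate of \<open>X\<close> is
  the sum of (g - 1)X, which lies one stage lower, and \<open>X\<close>.\<close>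

lemma flag_mono_stable:
  "flag G i \<subseteq> flag G (Suc i) \<and> (\<forall>g\<in>carrier G. \<forall>X\<in>flag G i. (\<lambda>x. g \<otimes> x) ` X \<in> flag G i)"
proof (induction i)
  case (Suc i)
  have "(\<lambda>x. g \<otimes> x) ` X \<in> flag G (Suc i)" if g: "g \<in> carrier G" and X: "X \<in> flag G (Suc i)" for g X
  proof -
    have "symdiff ((\<lambda>x. g \<otimes> x) ` X) X \<in> flag G (Suc i)" using Suc.IH X g by auto
    from flag_symdiff[OF this X] show ?thesis
      by (rule back_subst[of "\<lambda>Z. Z \<in> flag G (Suc i)"]) blast
  qed
  moreover have "flag G (Suc i) \<subseteq> flag G (Suc (Suc i))"
  proof
    fix X assume X: "X \<in> flag G (Suc i)"
    have "symdiff ((\<lambda>x. g \<otimes> x) ` X) X \<in> flag G (Suc i)" if "g \<in> carrier G" for g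
      using Suc.IH X that by auto
    then show "X \<in> flag G (Suc (Suc i))" using X by simp
  qed
  ultimately show ?case by blast
qed simp

lemma subgroup_flag: "subgroup (flag G i) (symdiff_group (carrier G))"
proof
  fix X assume "X \<in> flag G i"
  then show "inv\<^bsub>symdiff_group (carrier G)\<^esub> X \<in> flag G i"
    using flag_subset[of i] by (auto simp: inv_symdiff_group)
qed (use flag_subset flag_symdiff flag_empty in \<open>auto simp: symdiff_group_def\<close>)

text \<open>Equivalently: the augmentation ideal of the group algebra of a finite 2-group over the field
  with two elements, whose elements are here the subsets of \<open>G\<close>, is nilpotent.\<close>

lemma flag_exhausts:
  assumes fin: "finite (carrier G)" and ord: "order G = 2 ^ k"
  shows "\<exists>n. flag G n = Pow (carrier G)"
proof (rule ccontr)
  assume no: "\<not> ?thesis"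
  let ?V = "symdiff_group (carrier G)"
  have fl: "finite (flag G i)" for i
    using fin flag_subset finite_subset finite_Pow_iff by metis
  \<comment> \<open>A coset of stage i that is fixed by \<open>G\<close> and differs from stage i
    has a representative X outside stage i with every (g - 1)X inside it, hence a new element of
    stage i + 1.\<close>
  have "flag G i \<subset> flag G (Suc i)" for i
  proof -
    have "\<exists>X\<in>carrier ?V - flag G i. \<forall>g\<in>carrier G. (\<lambda>x. g \<otimes> x) ` X \<otimes>\<^bsub>?V\<^esub> inv\<^bsub>?V\<^esub> X \<in> flag G i"
    proof (rule two_group_fixed_coset[where a = "\<lambda>g X. (\<lambda>x. g \<otimes> x) ` X", OF is_group ord group_symdiff_group _ subgroup_flag])
      show "order ?V = 2 ^ order G" by (simp add: order_def symdiff_group_def card_Pow fin)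
      show "flag G i \<noteq> carrier ?V" using no by (simp add: symdiff_group_def)
      show "(\<lambda>X. (\<lambda>x. g \<otimes> x) ` X) \<in> hom ?V ?V" if "g \<in> carrier G" for g
        using that by (intro homI) (auto simp: symdiff_group_def translate_symdiff)
      show "(\<lambda>x. \<one> \<otimes> x) ` X = X" if "X \<in> carrier ?V" for X
        using that by (force simp: symdiff_group_def image_iff)
      show "(\<lambda>x. g \<otimes> h \<otimes> x) ` X = (\<lambda>x. g \<otimes> x) ` (\<lambda>x. h \<otimes> x) ` X"
        if "g \<in> carrier G" "h \<in> carrier G" "X \<in> carrier ?V" for g h X
      proof -
        have "\<And>x. x \<in> X \<Longrightarrow> g \<otimes> h \<otimes> x = g \<otimes> (h \<otimes> x)"
          using that by (auto simp: symdiff_group_def m_assoc subset_iff)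
        then show ?thesis by (simp add: image_image)
      qed
      show "(\<lambda>x. g \<otimes> x) ` X \<in> flag G i" if "g \<in> carrier G" "X \<in> flag G i" for g X
        using flag_mono_stable that by blast
    qed
    then obtain X where X: "X \<in> carrier ?V - flag G i"
      "\<forall>g\<in>carrier G. (\<lambda>x. g \<otimes> x) ` X \<otimes>\<^bsub>?V\<^esub> inv\<^bsub>?V\<^esub> X \<in> flag G i" by blast
    have "X \<subseteq> carrier G" using X(1) by (simp add: symdiff_group_def)
    then have "X \<in> flag G (Suc i)"
      using X(2) by (simp add: inv_symdiff_group) (simp add: symdiff_group_def)
    then show ?thesis using flag_mono_stable X(1) by blast
  qed
  then have step: "card (flag G i) < card (flag G (Suc i))" for i
    by (intro psubset_card_mono fl)
  \<comment> \<open>Strict growth at every stage would make the stages outgrow the finite power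
    set.\<close>
  have "i \<le> card (flag G i)" for i
    by (induction i) (use step in \<open>auto intro: Suc_leI le_less_trans\<close>)
  moreover have "card (flag G i) \<le> card (Pow (carrier G))" for i
    using fin flag_subset by (intro card_mono) auto
  ultimately show False by (meson not_less_eq_eq order_trans)
qed

text \<open>By Cauchy's theorem each prime divisor of the order is the order of some element, and
  element orders are powers of two. So 2 is the only prime in the factorisation of the
  order.\<close>

lemma finite_two_group_order:
  assumes "finite (carrier G)" "\<And>g. g \<in> carrier G \<Longrightarrow> \<exists>n. g [^] (2 ^ n :: nat) = \<one>"
  shows "\<exists>k. order G = 2 ^ k"
proof -
  have pos: "order G \<noteq> 0" using assms(1) order_gt_0_iff_finite by simp
  have p2: "p = 2" if p: "prime p" "p dvd order G" for p
  proof -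
    \<comment> \<open>The exponent 1 reduces the Sylow theorem to Cauchy's: a subgroup of order
      p.\<close>
    obtain m where m: "order G = p ^ 1 * m" using p(2) by (auto elim: dvdE)
    obtain H where H: "subgroup H G" "card H = p ^ 1" using sylow_thm[OF p(1) is_group m assms(1)] by blast
    interpret H: subgroup H G by (rule H(1))
    have "H \<noteq> {\<one>}" using H(2) p(1) by (auto simp: prime_nat_iff)
    then obtain h where h: "h \<in> H" "h \<noteq> \<one>" using H.one_closed by blast
    have hG: "h \<in> carrier G" using h(1) H.mem_carrier by blast
    have "h [^] card H = \<one>"
      using group.pow_order_eq_1[OF H.subgroup_is_group[OF is_group], of h] h(1)
      by (simp add: order_def flip: nat_pow_consistent)
    then have "ord h dvd p" using pow_eq_id[OF hG] H(2) by simp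
    moreover obtain n where n: "ord h = 2 ^ n"
      using assms(2)[OF hG] pow_eq_id[OF hG] divides_primepow_nat two_is_prime_nat by metis
    moreover have "n \<noteq> 0" using n h(2) ord_eq_1[OF hG] by (cases n) auto
    ultimately have "2 dvd p" by (metis dvd_power dvd_trans gr0I)
    then show ?thesis using p(1) primes_dvd_imp_eq two_is_prime_nat by blast
  qed
  have "order G = (\<Prod>p\<in>prime_factors (order G). p ^ multiplicity p (order G))"
    using pos by (simp add: prime_factorization_nat)
  also have "\<dots> = (\<Prod>p\<in>prime_factors (order G). 2 ^ multiplicity p (order G))"
    using p2 by (intro prod.cong) (auto simp: in_prime_factors_iff)
  also have "\<dots> = 2 ^ (\<Sum>p\<in>prime_factors (order G). multiplicity p (order G))"
    by (simp add: power_sum)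
  finally show ?thesis by blast
qed

end

section \<open>Group rings\<close>

locale group_ring_over = R: ring R + G: group G
  for R :: "('a, 'b) ring_scheme" (structure) and G :: "('g, 'c) monoid_scheme"
begin

abbreviation gmult (infixl "\<cdot>" 70) where "x \<cdot> y \<equiv> x \<otimes>\<^bsub>G\<^esub> y"
abbreviation S where "S \<equiv> group_ring R G"
abbreviation supp where "supp \<equiv> supp_gr R G"

text \<open>The monomial r g. With g the identity this is the embedding of the coefficient
  ring.\<close>

definition mon :: "'a \<Rightarrow> 'g \<Rightarrow> 'g \<Rightarrow> 'a" where
  "mon r g = (\<lambda>x\<in>carrier G. if x = g then r else \<zero>)"

definition aug :: "('g \<Rightarrow> 'a) \<Rightarrow> 'a" where
  "aug f = (\<Oplus>x\<in>supp f. f x)"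

lemma S_ext:
  assumes "f \<in> carrier S" "h \<in> carrier S" "\<And>x. x \<in> carrier G \<Longrightarrow> f x = h x"
  shows "f = h"
proof (rule PiE_ext)
  show "f \<in> carrier G \<rightarrow>\<^sub>E carrier R" "h \<in> carrier G \<rightarrow>\<^sub>E carrier R"
    using assms by (simp_all add: group_ring_def gr_carrier_def)
qed (use assms in simp)

lemma S_memI:
  assumes "\<And>x. x \<in> carrier G \<Longrightarrow> f x \<in> carrier R" "finite A"
    "\<And>x. x \<in> carrier G \<Longrightarrow> x \<notin> A \<Longrightarrow> f x = \<zero>"
  shows "restrict f (carrier G) \<in> carrier S"
proof -
  have "supp (restrict f (carrier G)) \<subseteq> A" using assms(3) by (auto simp: supp_gr_def)
  from finite_subset[OF this assms(2)] show ?thesis using assms(1)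
    by (simp add: group_ring_def gr_carrier_def restrict_PiE_iff)
qed

lemma coeff_closed [simp]: "f \<in> carrier S \<Longrightarrow> x \<in> carrier G \<Longrightarrow> f x \<in> carrier R"
  by (auto simp: group_ring_def gr_carrier_def)

lemma finite_supp [simp]: "f \<in> carrier S \<Longrightarrow> finite (supp f)"
  by (simp add: group_ring_def gr_carrier_def)

lemma supp_subset [simp]: "supp f \<subseteq> carrier G"
  by (auto simp: supp_gr_def)

lemma coeff_outside: "x \<in> carrier G \<Longrightarrow> x \<notin> supp f \<Longrightarrow> f x = \<zero>"
  by (simp add: supp_gr_def)

lemma add_coeff [simp]: "x \<in> carrier G \<Longrightarrow> (f \<oplus>\<^bsub>S\<^esub> h) x = f x \<oplus> h x"
  by (simp add: group_ring_def gr_add_def)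

lemma supp_add: "supp (f \<oplus>\<^bsub>S\<^esub> h) \<subseteq> supp f \<union> supp h"
  by (auto simp: supp_gr_def)

lemma zero_coeff [simp]: "x \<in> carrier G \<Longrightarrow> \<zero>\<^bsub>S\<^esub> x = \<zero>"
  by (simp add: group_ring_def gr_zero_def)

lemma one_eq_mon: "\<one>\<^bsub>S\<^esub> = mon \<one> \<one>\<^bsub>G\<^esub>"
  by (simp add: group_ring_def gr_one_def mon_def)

lemma mon_coeff [simp]: "x \<in> carrier G \<Longrightarrow> mon r g x = (if x = g then r else \<zero>)"
  by (simp add: mon_def)

lemma mon_closed [simp]: "r \<in> carrier R \<Longrightarrow> mon r g \<in> carrier S"
  unfolding mon_def by (rule S_memI[of _ "{g}"]) auto

lemma supp_mon: "supp (mon r g) \<subseteq> {g}"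
  by (auto simp: supp_gr_def split: if_splits)

text \<open>Convolution is defined by a sum over \<open>supp f\<close>, a range that changes with
  \<open>f\<close>. Allowing any finite \<open>A\<close> around the support lets sums for different
  elements be added and exchanged over one range.\<close>

lemma mult_coeff:
  assumes "f \<in> carrier S" "h \<in> carrier S" "finite A" "supp f \<subseteq> A" "A \<subseteq> carrier G" "x \<in> carrier G"
  shows "(f \<otimes>\<^bsub>S\<^esub> h) x = (\<Oplus>y\<in>A. f y \<otimes> h (inv\<^bsub>G\<^esub> y \<cdot> x))"
proof -
  have "(\<Oplus>y\<in>supp f. f y \<otimes> h (inv\<^bsub>G\<^esub> y \<cdot> x)) = (\<Oplus>y\<in>A. f y \<otimes> h (inv\<^bsub>G\<^esub> y \<cdot> x))"
    using assms by (intro R.add.finprod_mono_neutral_cong_left) (auto simp: coeff_outside subset_iff)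
  then show ?thesis using assms(6) by (simp add: group_ring_def gr_mult_def)
qed

lemma supp_mult:
  assumes "f \<in> carrier S" "h \<in> carrier S"
  shows "supp (f \<otimes>\<^bsub>S\<^esub> h) \<subseteq> (\<lambda>(y, z). y \<cdot> z) ` (supp f \<times> supp h)"
proof
  fix x assume x: "x \<in> supp (f \<otimes>\<^bsub>S\<^esub> h)"
  have xG: "x \<in> carrier G" using x by (simp add: supp_gr_def)
  have "\<exists>y\<in>supp f. inv\<^bsub>G\<^esub> y \<cdot> x \<in> supp h"
  proof (rule ccontr)
    assume no: "\<not> ?thesis"
    have "f y \<otimes> h (inv\<^bsub>G\<^esub> y \<cdot> x) = \<zero>" if "y \<in> supp f" for y
    proof -
      have "y \<in> carrier G" using that supp_subset by blast
      then show ?thesis using no that xG assms(1) coeff_outside[of "inv\<^bsub>G\<^esub> y \<cdot> x" h] by auto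
    qed
    then have "(f \<otimes>\<^bsub>S\<^esub> h) x = \<zero>"
      using mult_coeff[OF assms _ order_refl _ xG] assms by (simp add: R.add.finprod_one_eqI)
    then show False using x by (simp add: supp_gr_def)
  qed
  then obtain y where y: "y \<in> supp f" "inv\<^bsub>G\<^esub> y \<cdot> x \<in> supp h" by blast
  have "y \<in> carrier G" using y supp_subset by blast
  then have "x = y \<cdot> (inv\<^bsub>G\<^esub> y \<cdot> x)" using xG by (simp flip: G.m_assoc)
  then show "x \<in> (\<lambda>(y, z). y \<cdot> z) ` (supp f \<times> supp h)"
    using y by (auto intro!: image_eqI[of _ _ "(y, inv\<^bsub>G\<^esub> y \<cdot> x)"])
qed

lemma add_closed [simp]:
  assumes "f \<in> carrier S" "h \<in> carrier S" shows "f \<oplus>\<^bsub>S\<^esub> h \<in> carrier S"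
proof -
  have "(\<lambda>x\<in>carrier G. f x \<oplus> h x) \<in> carrier S"
    using assms by (intro S_memI[of _ "supp f \<union> supp h"]) (auto simp: coeff_outside)
  then show ?thesis by (simp add: group_ring_def gr_add_def)
qed

lemma zero_closed [simp]: "\<zero>\<^bsub>S\<^esub> \<in> carrier S"
proof -
  have "(\<lambda>x\<in>carrier G. \<zero>) \<in> carrier S" by (intro S_memI[of _ "{}"]) auto
  then show ?thesis by (simp add: group_ring_def gr_zero_def)
qed

lemma mult_closed [simp]:
  assumes "f \<in> carrier S" "h \<in> carrier S" shows "f \<otimes>\<^bsub>S\<^esub> h \<in> carrier S"
proof -
  have "(f \<otimes>\<^bsub>S\<^esub> h) x \<in> carrier R" if "x \<in> carrier G" for x
    using assms that mult_coeff[OF assms _ order_refl _ that] supp_subset[of f]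
    by (auto intro!: R.finsum_closed simp: subset_iff)
  moreover have "finite (supp (f \<otimes>\<^bsub>S\<^esub> h))"
    using finite_subset[OF supp_mult[OF assms]] assms by simp
  moreover have "f \<otimes>\<^bsub>S\<^esub> h = restrict (f \<otimes>\<^bsub>S\<^esub> h) (carrier G)"
    by (simp add: group_ring_def gr_mult_def)
  ultimately show ?thesis using S_memI[of "f \<otimes>\<^bsub>S\<^esub> h" "supp (f \<otimes>\<^bsub>S\<^esub> h)"] coeff_outside by metis
qed

text \<open>The substitution z = y w. As \<open>F\<close> vanishes off \<open>B\<close>, the range
  \<open>D\<close> has only to contain the translate of \<open>B\<close>, so one \<open>D\<close>
  can serve many \<open>y\<close> at once.\<close>

lemma translate_sum:
  assumes "y \<in> carrier G" "finite D" "D \<subseteq> carrier G" "B \<subseteq> carrier G" "(\<lambda>w. y \<cdot> w) ` B \<subseteq> D"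
    "\<And>w. w \<in> carrier G \<Longrightarrow> F w \<in> carrier R" "\<And>w. w \<in> carrier G \<Longrightarrow> w \<notin> B \<Longrightarrow> F w = \<zero>"
  shows "(\<Oplus>z\<in>D. F (inv\<^bsub>G\<^esub> y \<cdot> z)) = (\<Oplus>w\<in>B. F w)"
proof -
  have inj: "inj_on (\<lambda>w. y \<cdot> w) B"
    using inj_on_subset[OF G.inj_on_cmult[OF assms(1)] assms(4)] .
  have cancel: "inv\<^bsub>G\<^esub> y \<cdot> (y \<cdot> w) = w" if "w \<in> carrier G" for w
    using that assms(1) by (simp flip: G.m_assoc)
  have "(\<Oplus>w\<in>B. F w) = (\<Oplus>w\<in>B. F (inv\<^bsub>G\<^esub> y \<cdot> (y \<cdot> w)))"
    using assms cancel by (intro R.finsum_cong' refl) auto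
  also have "\<dots> = (\<Oplus>z\<in>(\<lambda>w. y \<cdot> w) ` B. F (inv\<^bsub>G\<^esub> y \<cdot> z))"
    using assms by (intro R.finsum_reindex[symmetric] inj) auto
  also have "\<dots> = (\<Oplus>z\<in>D. F (inv\<^bsub>G\<^esub> y \<cdot> z))"
  proof (rule R.add.finprod_mono_neutral_cong_left[OF assms(2,5)])
    fix z assume z: "z \<in> D - (\<lambda>w. y \<cdot> w) ` B"
    have zG: "z \<in> carrier G" using z assms(3) by blast
    have "z = y \<cdot> (inv\<^bsub>G\<^esub> y \<cdot> z)" using zG assms(1) by (simp flip: G.m_assoc)
    then have "inv\<^bsub>G\<^esub> y \<cdot> z \<notin> B" using z by blast
    then show "F (inv\<^bsub>G\<^esub> y \<cdot> z) = \<zero>" using zG assms by simp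
  qed (use assms in auto)
  finally show ?thesis by simp
qed

text \<open>A single range that fits both the product and all translates needed by
  \<open>translate_sum\<close>, chosen before the double sums are exchanged.\<close>

lemma prod_set:
  assumes "f \<in> carrier S" "h \<in> carrier S"
  obtains D where "finite D" "D \<subseteq> carrier G" "supp (f \<otimes>\<^bsub>S\<^esub> h) \<subseteq> D"
    "\<And>y. y \<in> supp f \<Longrightarrow> (\<lambda>w. y \<cdot> w) ` supp h \<subseteq> D"
proof
  let ?D = "(\<lambda>(y, z). y \<cdot> z) ` (supp f \<times> supp h)"
  show "finite ?D" using assms by simp
  show "?D \<subseteq> carrier G" using supp_subset by (auto simp: subset_iff)
  show "supp (f \<otimes>\<^bsub>S\<^esub> h) \<subseteq> ?D" by (rule supp_mult[OF assms])
  show "(\<lambda>w. y \<cdot> w) ` supp h \<subseteq> ?D" if "y \<in> supp f" for y using that by blast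
qed

text \<open>Expanding the left side sums over z in \<open>D\<close> and y in \<open>supp f\<close>.
  After the exchange, y is fixed and z = y w turns the inner sum into a coefficient of the product
  of \<open>g\<close> and \<open>h\<close>.\<close>

lemma mult_assoc:
  assumes f: "f \<in> carrier S" and g: "g \<in> carrier S" and h: "h \<in> carrier S"
  shows "f \<otimes>\<^bsub>S\<^esub> g \<otimes>\<^bsub>S\<^esub> h = f \<otimes>\<^bsub>S\<^esub> (g \<otimes>\<^bsub>S\<^esub> h)"
proof (rule S_ext)
  fix x assume x: "x \<in> carrier G"
  obtain D where D: "finite D" "D \<subseteq> carrier G" "supp (f \<otimes>\<^bsub>S\<^esub> g) \<subseteq> D"
    "\<And>y. y \<in> supp f \<Longrightarrow> (\<lambda>w. y \<cdot> w) ` supp g \<subseteq> D"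
    using prod_set[OF f g] by blast
  have sf: "y \<in> carrier G" if "y \<in> supp f" for y using that supp_subset by blast
  have sg: "y \<in> carrier G" if "y \<in> supp g" for y using that supp_subset by blast
  have sD: "z \<in> carrier G" if "z \<in> D" for z using that D(2) by blast
  have "(f \<otimes>\<^bsub>S\<^esub> g \<otimes>\<^bsub>S\<^esub> h) x = (\<Oplus>z\<in>D. (f \<otimes>\<^bsub>S\<^esub> g) z \<otimes> h (inv\<^bsub>G\<^esub> z \<cdot> x))"
    using mult_coeff[OF _ h D(1,3,2) x] f g by simp
  also have "\<dots> = (\<Oplus>z\<in>D. (\<Oplus>y\<in>supp f. f y \<otimes> g (inv\<^bsub>G\<^esub> y \<cdot> z)) \<otimes> h (inv\<^bsub>G\<^esub> z \<cdot> x))"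
    using f g h x sD sf by (intro R.finsum_cong') (auto simp: mult_coeff[OF f g _ order_refl])
  also have "\<dots> = (\<Oplus>z\<in>D. \<Oplus>y\<in>supp f. f y \<otimes> g (inv\<^bsub>G\<^esub> y \<cdot> z) \<otimes> h (inv\<^bsub>G\<^esub> z \<cdot> x))"
    using f g h x sD sf by (intro R.finsum_cong') (auto simp: R.finsum_ldistr Pi_def)
  also have "\<dots> = (\<Oplus>y\<in>supp f. \<Oplus>z\<in>D. f y \<otimes> g (inv\<^bsub>G\<^esub> y \<cdot> z) \<otimes> h (inv\<^bsub>G\<^esub> z \<cdot> x))"
    using f g h x sD sf D(1) by (intro R.finsum_swap) auto
  also have "\<dots> = (\<Oplus>y\<in>supp f. f y \<otimes> (g \<otimes>\<^bsub>S\<^esub> h) (inv\<^bsub>G\<^esub> y \<cdot> x))"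
  proof (rule R.finsum_cong'[OF refl])
    fix y assume y: "y \<in> supp f"
    have yG: "y \<in> carrier G" using y sf by blast
    let ?F = "\<lambda>w. f y \<otimes> g w \<otimes> h (inv\<^bsub>G\<^esub> w \<cdot> (inv\<^bsub>G\<^esub> y \<cdot> x))"
    have "(\<Oplus>z\<in>D. f y \<otimes> g (inv\<^bsub>G\<^esub> y \<cdot> z) \<otimes> h (inv\<^bsub>G\<^esub> z \<cdot> x)) = (\<Oplus>z\<in>D. ?F (inv\<^bsub>G\<^esub> y \<cdot> z))"
    proof (rule R.finsum_cong'[OF refl])
      fix z assume z: "z \<in> D"
      have "inv\<^bsub>G\<^esub> (inv\<^bsub>G\<^esub> y \<cdot> z) \<cdot> (inv\<^bsub>G\<^esub> y \<cdot> x) = inv\<^bsub>G\<^esub> z \<cdot> (y \<cdot> (inv\<^bsub>G\<^esub> y \<cdot> x))"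
        using yG sD[OF z] x by (simp add: G.inv_mult_group G.m_assoc)
      also have "y \<cdot> (inv\<^bsub>G\<^esub> y \<cdot> x) = x" using yG x by (simp flip: G.m_assoc)
      finally show "f y \<otimes> g (inv\<^bsub>G\<^esub> y \<cdot> z) \<otimes> h (inv\<^bsub>G\<^esub> z \<cdot> x) = ?F (inv\<^bsub>G\<^esub> y \<cdot> z)" by simp
    qed (use f g h x yG sD in auto)
    also have "\<dots> = (\<Oplus>w\<in>supp g. ?F w)"
      using f g h x yG D y by (intro translate_sum) (auto simp: coeff_outside)
    also have "\<dots> = (\<Oplus>w\<in>supp g. f y \<otimes> (g w \<otimes> h (inv\<^bsub>G\<^esub> w \<cdot> (inv\<^bsub>G\<^esub> y \<cdot> x))))"
      using f g h x yG sg by (intro R.finsum_cong') (auto simp: R.m_assoc)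
    also have "\<dots> = f y \<otimes> (\<Oplus>w\<in>supp g. g w \<otimes> h (inv\<^bsub>G\<^esub> w \<cdot> (inv\<^bsub>G\<^esub> y \<cdot> x)))"
      using f g h x yG sg by (subst R.finsum_rdistr) auto
    also have "\<dots> = f y \<otimes> (g \<otimes>\<^bsub>S\<^esub> h) (inv\<^bsub>G\<^esub> y \<cdot> x)"
      using g x yG by (simp add: mult_coeff[OF g h _ order_refl])
    finally show "(\<Oplus>z\<in>D. f y \<otimes> g (inv\<^bsub>G\<^esub> y \<cdot> z) \<otimes> h (inv\<^bsub>G\<^esub> z \<cdot> x)) = f y \<otimes> (g \<otimes>\<^bsub>S\<^esub> h) (inv\<^bsub>G\<^esub> y \<cdot> x)" .
  qed (use f g h x sf in auto)
  also have "\<dots> = (f \<otimes>\<^bsub>S\<^esub> (g \<otimes>\<^bsub>S\<^esub> h)) x"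
    using f g h x by (simp add: mult_coeff[OF f _ _ order_refl])
  finally show "(f \<otimes>\<^bsub>S\<^esub> g \<otimes>\<^bsub>S\<^esub> h) x = (f \<otimes>\<^bsub>S\<^esub> (g \<otimes>\<^bsub>S\<^esub> h)) x" .
qed (use assms in simp_all)

lemma mon_mult_coeff [simp]:
  assumes "r \<in> carrier R" "g \<in> carrier G" "f \<in> carrier S" "x \<in> carrier G"
  shows "(mon r g \<otimes>\<^bsub>S\<^esub> f) x = r \<otimes> f (inv\<^bsub>G\<^esub> g \<cdot> x)"
  using mult_coeff[of "mon r g" f "{g}" x] assms supp_mon by simp

lemma mult_mon_coeff [simp]:
  assumes "r \<in> carrier R" "g \<in> carrier G" "f \<in> carrier S" "x \<in> carrier G"
  shows "(f \<otimes>\<^bsub>S\<^esub> mon r g) x = f (x \<cdot> inv\<^bsub>G\<^esub> g) \<otimes> r"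
proof -
  \<comment> \<open>The only contributing index is inserted by hand: it may lie outside
    \<open>supp f\<close>, and then it contributes the coefficient zero.\<close>
  let ?A = "insert (x \<cdot> inv\<^bsub>G\<^esub> g) (supp f)"
  have A: "?A \<subseteq> carrier G" "finite ?A" using assms by auto
  have "inv\<^bsub>G\<^esub> y \<cdot> x = g \<longleftrightarrow> x \<cdot> inv\<^bsub>G\<^esub> g = y" if "y \<in> carrier G" for y
    using assms that by (metis G.inv_closed G.inv_solve_left G.inv_solve_right G.inv_inv)
  then have "(f \<otimes>\<^bsub>S\<^esub> mon r g) x = (\<Oplus>y\<in>?A. if x \<cdot> inv\<^bsub>G\<^esub> g = y then f y \<otimes> r else \<zero>)"
    using assms A unfolding mult_coeff[OF assms(3) mon_closed[OF assms(1)] A(2) subset_insertI A(1) assms(4)]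
    by (intro R.finsum_cong') (auto simp: supp_gr_def)
  also have "\<dots> = f (x \<cdot> inv\<^bsub>G\<^esub> g) \<otimes> r"
    by (rule R.finsum_singleton) (use A assms in \<open>auto simp: subset_iff\<close>)
  finally show ?thesis .
qed

lemma S_ring: "ring S"
proof (rule ringI)
  show "abelian_group S"
  proof (rule abelian_groupI)
    fix f assume f: "f \<in> carrier S"
    have "(\<lambda>x\<in>carrier G. \<ominus> f x) \<in> carrier S"
      using f by (intro S_memI[of _ "supp f"]) (auto simp: coeff_outside)
    moreover from this have "(\<lambda>x\<in>carrier G. \<ominus> f x) \<oplus>\<^bsub>S\<^esub> f = \<zero>\<^bsub>S\<^esub>"
      using f by (intro S_ext) (auto simp: R.l_neg)
    ultimately show "\<exists>h\<in>carrier S. h \<oplus>\<^bsub>S\<^esub> f = \<zero>\<^bsub>S\<^esub>" by blast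
  qed (auto intro!: S_ext simp: R.a_ac)
  show "monoid S"
    by (rule monoidI) (simp_all add: mult_assoc one_eq_mon S_ext)
  fix f g h assume S: "f \<in> carrier S" "g \<in> carrier S" "h \<in> carrier S"
  show "(f \<oplus>\<^bsub>S\<^esub> g) \<otimes>\<^bsub>S\<^esub> h = f \<otimes>\<^bsub>S\<^esub> h \<oplus>\<^bsub>S\<^esub> g \<otimes>\<^bsub>S\<^esub> h"
  proof (rule S_ext)
    fix x assume x: "x \<in> carrier G"
    let ?A = "supp f \<union> supp g"
    have A: "finite ?A" "?A \<subseteq> carrier G" "supp f \<subseteq> ?A" "supp g \<subseteq> ?A" "supp (f \<oplus>\<^bsub>S\<^esub> g) \<subseteq> ?A"
      using S supp_add by simp_all
    have "((f \<oplus>\<^bsub>S\<^esub> g) \<otimes>\<^bsub>S\<^esub> h) x = (\<Oplus>y\<in>?A. f y \<otimes> h (inv\<^bsub>G\<^esub> y \<cdot> x) \<oplus> g y \<otimes> h (inv\<^bsub>G\<^esub> y \<cdot> x))"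
      unfolding mult_coeff[OF add_closed[OF S(1,2)] S(3) A(1) A(5) A(2) x]
      using S x A(2) by (intro R.finsum_cong') (auto simp: R.l_distr subset_iff)
    also have "\<dots> = (f \<otimes>\<^bsub>S\<^esub> h \<oplus>\<^bsub>S\<^esub> g \<otimes>\<^bsub>S\<^esub> h) x"
      using S x A(2) mult_coeff[OF S(1,3) A(1,3,2) x] mult_coeff[OF S(2,3) A(1,4,2) x]
      by (subst R.finsum_addf) (auto simp: subset_iff)
    finally show "((f \<oplus>\<^bsub>S\<^esub> g) \<otimes>\<^bsub>S\<^esub> h) x = (f \<otimes>\<^bsub>S\<^esub> h \<oplus>\<^bsub>S\<^esub> g \<otimes>\<^bsub>S\<^esub> h) x" .
  qed (use S in simp_all)
  show "h \<otimes>\<^bsub>S\<^esub> (f \<oplus>\<^bsub>S\<^esub> g) = h \<otimes>\<^bsub>S\<^esub> f \<oplus>\<^bsub>S\<^esub> h \<otimes>\<^bsub>S\<^esub> g"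
  proof (rule S_ext)
    fix x assume x: "x \<in> carrier G"
    have s: "y \<in> carrier G" if "y \<in> supp h" for y using that supp_subset by blast
    have "(h \<otimes>\<^bsub>S\<^esub> (f \<oplus>\<^bsub>S\<^esub> g)) x = (\<Oplus>y\<in>supp h. h y \<otimes> f (inv\<^bsub>G\<^esub> y \<cdot> x) \<oplus> h y \<otimes> g (inv\<^bsub>G\<^esub> y \<cdot> x))"
      unfolding mult_coeff[OF S(3) add_closed[OF S(1,2)] finite_supp[OF S(3)] order_refl supp_subset x]
      using S x s by (intro R.finsum_cong') (auto simp: R.r_distr)
    also have "\<dots> = (h \<otimes>\<^bsub>S\<^esub> f \<oplus>\<^bsub>S\<^esub> h \<otimes>\<^bsub>S\<^esub> g) x"
      using S x s by (subst R.finsum_addf) (auto simp: mult_coeff[OF S(3) _ finite_supp[OF S(3)] order_refl])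
    finally show "(h \<otimes>\<^bsub>S\<^esub> (f \<oplus>\<^bsub>S\<^esub> g)) x = (h \<otimes>\<^bsub>S\<^esub> f \<oplus>\<^bsub>S\<^esub> h \<otimes>\<^bsub>S\<^esub> g) x" .
  qed (use S in simp_all)
qed

sublocale S: ring S by (rule S_ring)

section \<open>The augmentation homomorphism\<close>

lemma aug_eq:
  assumes "f \<in> carrier S" "finite A" "supp f \<subseteq> A" "A \<subseteq> carrier G"
  shows "aug f = (\<Oplus>x\<in>A. f x)"
  unfolding aug_def using assms
  by (intro R.add.finprod_mono_neutral_cong_left) (auto simp: coeff_outside subset_iff)

lemma aug_closed [simp]: "f \<in> carrier S \<Longrightarrow> aug f \<in> carrier R"
  unfolding aug_def using supp_subset[of f] by (auto intro!: R.finsum_closed simp: subset_iff)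

lemma aug_add [simp]:
  assumes "f \<in> carrier S" "h \<in> carrier S" shows "aug (f \<oplus>\<^bsub>S\<^esub> h) = aug f \<oplus> aug h"
proof -
  let ?A = "supp f \<union> supp h"
  have A: "finite ?A" "?A \<subseteq> carrier G" "supp f \<subseteq> ?A" "supp h \<subseteq> ?A" "supp (f \<oplus>\<^bsub>S\<^esub> h) \<subseteq> ?A"
    using assms supp_add by simp_all
  have "aug (f \<oplus>\<^bsub>S\<^esub> h) = (\<Oplus>x\<in>?A. f x \<oplus> h x)"
    unfolding aug_eq[OF add_closed[OF assms] A(1,5,2)]
    using assms A(2) by (intro R.finsum_cong') (auto simp: subset_iff)
  also have "\<dots> = aug f \<oplus> aug h"
    unfolding aug_eq[OF assms(1) A(1,3,2)] aug_eq[OF assms(2) A(1,4,2)]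
    using assms A(2) by (intro R.finsum_addf) (auto simp: subset_iff)
  finally show ?thesis .
qed

text \<open>For fixed y the inner sum runs over a translate of \<open>h\<close>, and translation
  does not change the sum of the coefficients.\<close>

lemma aug_mult [simp]:
  assumes f: "f \<in> carrier S" and h: "h \<in> carrier S"
  shows "aug (f \<otimes>\<^bsub>S\<^esub> h) = aug f \<otimes> aug h"
proof -
  obtain D where D: "finite D" "D \<subseteq> carrier G" "supp (f \<otimes>\<^bsub>S\<^esub> h) \<subseteq> D"
    "\<And>y. y \<in> supp f \<Longrightarrow> (\<lambda>w. y \<cdot> w) ` supp h \<subseteq> D"
    using prod_set[OF f h] by blast
  have sf: "y \<in> carrier G" if "y \<in> supp f" for y using that supp_subset by blast
  have sD: "z \<in> carrier G" if "z \<in> D" for z using that D(2) by blast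
  have "aug (f \<otimes>\<^bsub>S\<^esub> h) = (\<Oplus>z\<in>D. \<Oplus>y\<in>supp f. f y \<otimes> h (inv\<^bsub>G\<^esub> y \<cdot> z))"
    unfolding aug_eq[OF mult_closed[OF f h] D(1,3,2)]
    using f h sD sf by (intro R.finsum_cong') (auto simp: mult_coeff[OF f h _ order_refl])
  also have "\<dots> = (\<Oplus>y\<in>supp f. \<Oplus>z\<in>D. f y \<otimes> h (inv\<^bsub>G\<^esub> y \<cdot> z))"
    using f h sD sf D(1) by (intro R.finsum_swap) auto
  also have "\<dots> = (\<Oplus>y\<in>supp f. f y \<otimes> aug h)"
  proof (rule R.finsum_cong'[OF refl])
    fix y assume y: "y \<in> supp f"
    have "(\<Oplus>z\<in>D. f y \<otimes> h (inv\<^bsub>G\<^esub> y \<cdot> z)) = f y \<otimes> (\<Oplus>z\<in>D. h (inv\<^bsub>G\<^esub> y \<cdot> z))"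
      using f h sD sf[OF y] D(1) by (subst R.finsum_rdistr) auto
    also have "(\<Oplus>z\<in>D. h (inv\<^bsub>G\<^esub> y \<cdot> z)) = aug h"
      unfolding aug_def using h sf[OF y] D y by (intro translate_sum) (auto simp: coeff_outside)
    finally show "(\<Oplus>z\<in>D. f y \<otimes> h (inv\<^bsub>G\<^esub> y \<cdot> z)) = f y \<otimes> aug h" .
  qed (use f h sf in auto)
  also have "\<dots> = aug f \<otimes> aug h"
    unfolding aug_def[of f] using f h sf by (subst R.finsum_ldistr) auto
  finally show ?thesis .
qed

lemma aug_mon [simp]:
  assumes "r \<in> carrier R" "g \<in> carrier G" shows "aug (mon r g) = r"
  using aug_eq[of "mon r g" "{g}"] assms supp_mon by simp

lemma aug_minus [simp]:
  assumes "f \<in> carrier S" shows "aug (\<ominus>\<^bsub>S\<^esub> f) = \<ominus> aug f"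
proof -
  have "aug \<zero>\<^bsub>S\<^esub> = \<zero>" by (simp add: aug_def supp_gr_def cong: conj_cong)
  moreover have "aug (\<ominus>\<^bsub>S\<^esub> f \<oplus>\<^bsub>S\<^esub> f) = aug \<zero>\<^bsub>S\<^esub>" using assms by (simp add: S.l_neg)
  ultimately show ?thesis using assms by (simp add: R.minus_equality)
qed

lemma aug_Units: "u \<in> Units S \<Longrightarrow> aug u \<in> Units R"
proof -
  assume u: "u \<in> Units S"
  then have c: "u \<in> carrier S" "inv\<^bsub>S\<^esub> u \<in> carrier S" by auto
  have one: "aug \<one>\<^bsub>S\<^esub> = \<one>" by (simp add: one_eq_mon)
  have "aug (inv\<^bsub>S\<^esub> u) \<otimes> aug u = \<one>" "aug u \<otimes> aug (inv\<^bsub>S\<^esub> u) = \<one>"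
    using u c one by (simp_all flip: aug_mult)
  then show ?thesis using c unfolding Units_def by auto
qed

subsection \<open>Units and the augmentation\<close>

lemma mon_mult_mon:
  assumes "r \<in> carrier R" "s \<in> carrier R" "g \<in> carrier G" "h \<in> carrier G"
  shows "mon r g \<otimes>\<^bsub>S\<^esub> mon s h = mon (r \<otimes> s) (g \<cdot> h)"
proof (rule S_ext)
  fix x assume x: "x \<in> carrier G"
  have "inv\<^bsub>G\<^esub> g \<cdot> x = h \<longleftrightarrow> x = g \<cdot> h" using assms x by (metis G.inv_solve_left)
  then show "(mon r g \<otimes>\<^bsub>S\<^esub> mon s h) x = mon (r \<otimes> s) (g \<cdot> h) x"
    using assms x by (simp del: mult_mon_coeff)
qed (use assms in simp_all)

lemma mon_add: "r \<in> carrier R \<Longrightarrow> s \<in> carrier R \<Longrightarrow> mon (r \<oplus> s) g = mon r g \<oplus>\<^bsub>S\<^esub> mon s g"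
  by (rule S_ext) simp_all

lemma mon_zero: "mon \<zero> g = \<zero>\<^bsub>S\<^esub>"
  by (rule S_ext) simp_all

lemma mon_Units:
  assumes "r \<in> Units R" shows "mon r \<one>\<^bsub>G\<^esub> \<in> Units S"
proof -
  have c: "r \<in> carrier R" "inv r \<in> carrier R" using assms by auto
  have "mon r \<one>\<^bsub>G\<^esub> \<otimes>\<^bsub>S\<^esub> mon (inv r) \<one>\<^bsub>G\<^esub> = \<one>\<^bsub>S\<^esub>" "mon (inv r) \<one>\<^bsub>G\<^esub> \<otimes>\<^bsub>S\<^esub> mon r \<one>\<^bsub>G\<^esub> = \<one>\<^bsub>S\<^esub>"
    using c assms by (simp_all add: mon_mult_mon one_eq_mon)
  then show ?thesis using c unfolding Units_def by auto
qed

lemma supp_empty: "f \<in> carrier S \<Longrightarrow> supp f = {} \<Longrightarrow> f = \<zero>\<^bsub>S\<^esub>"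
  by (rule S_ext) (auto simp: coeff_outside)

text \<open>Splits off one monomial so that the support shrinks; this drives the inductions over
  finite sets of group elements.\<close>

lemma split_coeff:
  assumes "f \<in> carrier S" "t \<in> carrier G"
  obtains f' where "f' \<in> carrier S" "supp f' \<subseteq> supp f - {t}" "f = f' \<oplus>\<^bsub>S\<^esub> mon (f t) t"
proof
  let ?f = "\<lambda>x\<in>carrier G. if x = t then \<zero> else f x"
  show f': "?f \<in> carrier S"
    using assms by (intro S_memI[of _ "supp f"]) (auto simp: coeff_outside)
  show "supp ?f \<subseteq> supp f - {t}" by (auto simp: supp_gr_def split: if_splits)
  show "f = ?f \<oplus>\<^bsub>S\<^esub> mon (f t) t" using assms f' by (intro S_ext) simp_all
qed

text \<open>Nakayama's lemma for the right \<open>R\<close>-module of elements supported on the finite subgroup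
  generated by \<open>supp s\<close>: its generators are eliminated one at a time modulo the right ideal
  \<open>(1 + 2 s) S\<close>.\<close>

lemma right_inverse_one_plus_double:
  assumes U: "\<And>r. r \<in> carrier R \<Longrightarrow> \<one> \<oplus> (r \<oplus> r) \<in> Units R"
    and lf: "locally_finite_group G" and s: "s \<in> carrier S"
  shows "\<exists>t\<in>carrier S. (\<one>\<^bsub>S\<^esub> \<oplus>\<^bsub>S\<^esub> (s \<oplus>\<^bsub>S\<^esub> s)) \<otimes>\<^bsub>S\<^esub> t = \<one>\<^bsub>S\<^esub>"
proof -
  define y where "y = \<one>\<^bsub>S\<^esub> \<oplus>\<^bsub>S\<^esub> (s \<oplus>\<^bsub>S\<^esub> s)"
  have y: "y \<in> carrier S" using s by (simp add: y_def)
  define H where "H = generate G (supp s)"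
  interpret H: subgroup H G unfolding H_def by (rule G.generate_is_subgroup) simp
  have finH: "finite H" using lf s unfolding H_def locally_finite_group_def by simp
  have sH: "supp s \<subseteq> H" unfolding H_def by (auto intro: generate.incl)
  \<comment> \<open>\<open>P T\<close> collects the elements congruent modulo the right ideal yS to
    one supported on \<open>T\<close>. In particular \<open>P {}\<close> is yS, and the aim is to
    find 1 in it.\<close>
  define P where "P T = {f \<in> carrier S. \<exists>a\<in>carrier S. \<exists>b\<in>carrier S. supp b \<subseteq> T \<and> f = y \<otimes>\<^bsub>S\<^esub> a \<oplus>\<^bsub>S\<^esub> b}" for T
  have P_I: "y \<otimes>\<^bsub>S\<^esub> a \<oplus>\<^bsub>S\<^esub> b \<in> P T" if "a \<in> carrier S" "b \<in> carrier S" "supp b \<subseteq> T" for a b T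
  proof -
    have "y \<otimes>\<^bsub>S\<^esub> a \<oplus>\<^bsub>S\<^esub> b \<in> carrier S" using that y by simp
    then show ?thesis using that unfolding P_def by blast
  qed
  have P_y: "y \<otimes>\<^bsub>S\<^esub> a \<in> P T" if "a \<in> carrier S" for a T
  proof -
    have "supp \<zero>\<^bsub>S\<^esub> \<subseteq> T" by (auto simp: supp_gr_def)
    from P_I[OF that zero_closed this] show ?thesis using that y by simp
  qed
  have P_supp: "b \<in> P T" if "b \<in> carrier S" "supp b \<subseteq> T" for b T
    using P_I[OF zero_closed that] that y by simp
  have P_add: "f \<oplus>\<^bsub>S\<^esub> g \<in> P T" if f: "f \<in> P T" and g: "g \<in> P T" for f g T
  proof -
    obtain a b where ab: "a \<in> carrier S" "b \<in> carrier S" "supp b \<subseteq> T" "f = y \<otimes>\<^bsub>S\<^esub> a \<oplus>\<^bsub>S\<^esub> b"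
      using f unfolding P_def by blast
    obtain c d where cd: "c \<in> carrier S" "d \<in> carrier S" "supp d \<subseteq> T" "g = y \<otimes>\<^bsub>S\<^esub> c \<oplus>\<^bsub>S\<^esub> d"
      using g unfolding P_def by blast
    have "f \<oplus>\<^bsub>S\<^esub> g = y \<otimes>\<^bsub>S\<^esub> (a \<oplus>\<^bsub>S\<^esub> c) \<oplus>\<^bsub>S\<^esub> (b \<oplus>\<^bsub>S\<^esub> d)"
      using ab cd y by (simp add: S.r_distr S.a_ac)
    moreover have "supp (b \<oplus>\<^bsub>S\<^esub> d) \<subseteq> T" using supp_add ab(3) cd(3) by blast
    ultimately show ?thesis using ab(1,2) cd(1,2) by (simp only: P_I add_closed)
  qed
  \<comment> \<open>Scalars act on the right because yS is a right ideal; such scaling does not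
    enlarge the support of the remainder.\<close>
  have P_scale: "f \<otimes>\<^bsub>S\<^esub> mon r \<one>\<^bsub>G\<^esub> \<in> P T" if f: "f \<in> P T" and r: "r \<in> carrier R" for f r T
  proof -
    obtain a b where ab: "a \<in> carrier S" "b \<in> carrier S" "supp b \<subseteq> T" "f = y \<otimes>\<^bsub>S\<^esub> a \<oplus>\<^bsub>S\<^esub> b"
      using f unfolding P_def by blast
    have "supp (b \<otimes>\<^bsub>S\<^esub> mon r \<one>\<^bsub>G\<^esub>) \<subseteq> supp b" using ab(2) r by (auto simp: supp_gr_def)
    then have "supp (b \<otimes>\<^bsub>S\<^esub> mon r \<one>\<^bsub>G\<^esub>) \<subseteq> T" using ab(3) by blast
    moreover have "f \<otimes>\<^bsub>S\<^esub> mon r \<one>\<^bsub>G\<^esub> = y \<otimes>\<^bsub>S\<^esub> (a \<otimes>\<^bsub>S\<^esub> mon r \<one>\<^bsub>G\<^esub>) \<oplus>\<^bsub>S\<^esub> b \<otimes>\<^bsub>S\<^esub> mon r \<one>\<^bsub>G\<^esub>"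
      using ab y r by (simp add: S.l_distr S.m_assoc)
    ultimately show ?thesis using ab(1,2) r by (simp only: P_I mult_closed mon_closed)
  qed
  \<comment> \<open>Modulo yS the identity yt = t + 2st gives t = -2st. Writing st as b' + ct with
    b' supported on \<open>T\<close> yields t(1 + 2c) = -2b', and 1 + 2c is invertible in R, so t
    itself is congruent to an element supported on \<open>T\<close>.\<close>
  have step: "\<forall>f\<in>carrier S. supp f \<subseteq> H \<longrightarrow> f \<in> P T"
    if t: "t \<in> H" and all: "\<forall>f\<in>carrier S. supp f \<subseteq> H \<longrightarrow> f \<in> P (insert t T)" for t T
  proof -
    have tG: "t \<in> carrier G" using t by (rule H.mem_carrier)
    let ?t = "mon \<one> t"
    have mon_t: "mon c t = ?t \<otimes>\<^bsub>S\<^esub> mon c \<one>\<^bsub>G\<^esub>" if "c \<in> carrier R" for c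
      using that tG by (simp add: mon_mult_mon)
    \<comment> \<open>This is why the generators range over a subgroup containing
      \<open>supp s\<close>: multiplication by s must not leave their span.\<close>
    have "supp (s \<otimes>\<^bsub>S\<^esub> ?t) \<subseteq> H"
    proof
      fix x assume x: "x \<in> supp (s \<otimes>\<^bsub>S\<^esub> ?t)"
      then have xG: "x \<in> carrier G" by (simp add: supp_gr_def)
      then have "x \<cdot> inv\<^bsub>G\<^esub> t \<in> H" using x sH s tG by (auto simp: supp_gr_def)
      then have "x \<cdot> inv\<^bsub>G\<^esub> t \<cdot> t \<in> H" using t by (rule H.m_closed)
      then show "x \<in> H" using xG tG by (simp add: G.m_assoc)
    qed
    then have "s \<otimes>\<^bsub>S\<^esub> ?t \<in> P (insert t T)" using all s by simp
    then obtain a b where ab: "a \<in> carrier S" "b \<in> carrier S" "supp b \<subseteq> insert t T"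
      "s \<otimes>\<^bsub>S\<^esub> ?t = y \<otimes>\<^bsub>S\<^esub> a \<oplus>\<^bsub>S\<^esub> b" unfolding P_def by blast
    obtain b' where b': "b' \<in> carrier S" "supp b' \<subseteq> supp b - {t}" "b = b' \<oplus>\<^bsub>S\<^esub> mon (b t) t"
      using split_coeff[OF ab(2) tG] .
    define c where "c = b t"
    have c: "c \<in> carrier R" using ab(2) tG by (simp add: c_def)
    define c' where "c' = \<one> \<oplus> (c \<oplus> c)"
    have c': "c' \<in> Units R" "c' \<in> carrier R" using U[OF c] c by (simp_all add: c'_def)
    define p where "p = y \<otimes>\<^bsub>S\<^esub> a"
    define z where "z = s \<otimes>\<^bsub>S\<^esub> ?t"
    have pz: "p \<in> carrier S" "z \<in> carrier S" using s y ab by (simp_all add: p_def z_def)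
    have z: "z = p \<oplus>\<^bsub>S\<^esub> (b' \<oplus>\<^bsub>S\<^esub> mon c t)" using ab(4) b'(3) by (simp add: z_def p_def c_def)
    have yt: "y \<otimes>\<^bsub>S\<^esub> ?t = ?t \<oplus>\<^bsub>S\<^esub> (z \<oplus>\<^bsub>S\<^esub> z)"
      using s tG by (simp add: y_def z_def S.l_distr)
    have "mon c' t = ?t \<oplus>\<^bsub>S\<^esub> (mon c t \<oplus>\<^bsub>S\<^esub> mon c t)" using c by (simp add: c'_def mon_add)
    also have "\<dots> = (?t \<oplus>\<^bsub>S\<^esub> (z \<oplus>\<^bsub>S\<^esub> z)) \<oplus>\<^bsub>S\<^esub> (\<ominus>\<^bsub>S\<^esub> (p \<oplus>\<^bsub>S\<^esub> p)) \<oplus>\<^bsub>S\<^esub> \<ominus>\<^bsub>S\<^esub> (b' \<oplus>\<^bsub>S\<^esub> b')"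
    proof -
      have mc: "mon c t \<in> carrier S" "?t \<in> carrier S" using c by simp_all
      show ?thesis unfolding z using mc pz(1) b'(1) by algebra
    qed
    \<comment> \<open>The subtraction becomes right multiplication by the scalar -1, so that
      additivity and scaling of \<open>P T\<close> suffice.\<close>
    also have "\<dots> = y \<otimes>\<^bsub>S\<^esub> (?t \<oplus>\<^bsub>S\<^esub> \<ominus>\<^bsub>S\<^esub> (a \<oplus>\<^bsub>S\<^esub> a)) \<oplus>\<^bsub>S\<^esub> (b' \<oplus>\<^bsub>S\<^esub> b') \<otimes>\<^bsub>S\<^esub> mon (\<ominus> \<one>) \<one>\<^bsub>G\<^esub>"
    proof -
      have "(b' \<oplus>\<^bsub>S\<^esub> b') \<otimes>\<^bsub>S\<^esub> mon (\<ominus> \<one>) \<one>\<^bsub>G\<^esub> = \<ominus>\<^bsub>S\<^esub> (b' \<oplus>\<^bsub>S\<^esub> b')"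
      proof -
        have "mon (\<ominus> \<one>) \<one>\<^bsub>G\<^esub> \<oplus>\<^bsub>S\<^esub> \<one>\<^bsub>S\<^esub> = \<zero>\<^bsub>S\<^esub>"
          by (simp add: one_eq_mon R.l_neg mon_zero flip: mon_add)
        then have "mon (\<ominus> \<one>) \<one>\<^bsub>G\<^esub> = \<ominus>\<^bsub>S\<^esub> \<one>\<^bsub>S\<^esub>" by (simp add: S.minus_equality)
        then show ?thesis using b'(1) by (simp add: S.r_minus)
      qed
      then show ?thesis using y ab(1) by (simp add: yt p_def S.r_distr S.r_minus)
    qed
    also have "\<dots> \<in> P T"
    proof -
      have "b' \<in> P T" using b' ab(3) by (intro P_supp) auto
      then show ?thesis using ab(1) by (intro P_add P_scale P_y) simp_all
    qed
    finally have "mon c' t \<otimes>\<^bsub>S\<^esub> mon (inv c') \<one>\<^bsub>G\<^esub> \<in> P T" using c' by (intro P_scale) auto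
    then have tP: "?t \<in> P T" using c' tG by (simp add: mon_mult_mon)
    show ?thesis
    proof (intro ballI impI)
      fix f assume f: "f \<in> carrier S" "supp f \<subseteq> H"
      then obtain a b where ab: "a \<in> carrier S" "b \<in> carrier S" "supp b \<subseteq> insert t T" "f = y \<otimes>\<^bsub>S\<^esub> a \<oplus>\<^bsub>S\<^esub> b"
        using all unfolding P_def by blast
      obtain b' where b': "b' \<in> carrier S" "supp b' \<subseteq> supp b - {t}" "b = b' \<oplus>\<^bsub>S\<^esub> mon (b t) t"
        using split_coeff[OF ab(2) tG] .
      have bt: "b t \<in> carrier R" using ab(2) tG by simp
      have "b' \<in> P T" using b' ab(3) by (intro P_supp) auto
      moreover have "mon (b t) t \<in> P T" unfolding mon_t[OF bt] by (rule P_scale[OF tP bt])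
      ultimately have "b \<in> P T" using b'(3) P_add by metis
      then show "f \<in> P T" unfolding ab(4) by (intro P_add P_y ab(1))
    qed
  qed
  \<comment> \<open>Starting from \<open>T = H\<close>, where the congruence is trivial with a = 0,
    all generators are removed.\<close>
  have "(\<forall>f\<in>carrier S. supp f \<subseteq> H \<longrightarrow> f \<in> P T) \<longrightarrow> (\<forall>f\<in>carrier S. supp f \<subseteq> H \<longrightarrow> f \<in> P {})"
    if "finite T" "T \<subseteq> H" for T
    using that
  proof (induction T rule: finite_induct)
    case (insert t T)
    then show ?case using step[of t T] by simp
  qed simp
  from this[OF finH order_refl] have "\<forall>f\<in>carrier S. supp f \<subseteq> H \<longrightarrow> f \<in> P {}"
    using P_supp by blast
  moreover have "supp \<one>\<^bsub>S\<^esub> \<subseteq> H" unfolding one_eq_mon using supp_mon H.one_closed by fastforce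
  ultimately have "\<one>\<^bsub>S\<^esub> \<in> P {}" by simp
  then obtain a b where ab: "a \<in> carrier S" "b \<in> carrier S" "supp b = {}" "\<one>\<^bsub>S\<^esub> = y \<otimes>\<^bsub>S\<^esub> a \<oplus>\<^bsub>S\<^esub> b"
    unfolding P_def by blast
  have "y \<otimes>\<^bsub>S\<^esub> a = \<one>\<^bsub>S\<^esub>" using ab y supp_empty[OF ab(2,3)] by simp
  then show ?thesis using ab(1) unfolding y_def by blast
qed

text \<open>A right inverse t of 1 + 2s equals 1 - 2st, which has the same shape and therefore has a
  right inverse too. An element with a left and a right inverse is a unit, so t and hence 1 + 2s are
  units.\<close>

lemma one_plus_double_Units_group_ring:
  assumes U: "\<And>r. r \<in> carrier R \<Longrightarrow> \<one> \<oplus> (r \<oplus> r) \<in> Units R"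
    and lf: "locally_finite_group G" and s: "s \<in> carrier S"
  shows "\<one>\<^bsub>S\<^esub> \<oplus>\<^bsub>S\<^esub> (s \<oplus>\<^bsub>S\<^esub> s) \<in> Units S"
proof -
  let ?y = "\<one>\<^bsub>S\<^esub> \<oplus>\<^bsub>S\<^esub> (s \<oplus>\<^bsub>S\<^esub> s)"
  have y: "?y \<in> carrier S" using s by simp
  obtain t where t: "t \<in> carrier S" "?y \<otimes>\<^bsub>S\<^esub> t = \<one>\<^bsub>S\<^esub>"
    using right_inverse_one_plus_double[OF assms] by blast
  define m where "m = s \<otimes>\<^bsub>S\<^esub> t"
  have m: "m \<in> carrier S" using s t by (simp add: m_def)
  have e: "t \<oplus>\<^bsub>S\<^esub> (m \<oplus>\<^bsub>S\<^esub> m) = \<one>\<^bsub>S\<^esub>" using t s by (simp add: m_def S.l_distr)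
  have "t = (t \<oplus>\<^bsub>S\<^esub> (m \<oplus>\<^bsub>S\<^esub> m)) \<oplus>\<^bsub>S\<^esub> (\<ominus>\<^bsub>S\<^esub> m \<oplus>\<^bsub>S\<^esub> \<ominus>\<^bsub>S\<^esub> m)" using t(1) m by algebra
  then have teq: "t = \<one>\<^bsub>S\<^esub> \<oplus>\<^bsub>S\<^esub> (\<ominus>\<^bsub>S\<^esub> m \<oplus>\<^bsub>S\<^esub> \<ominus>\<^bsub>S\<^esub> m)" unfolding e .
  obtain u where u: "u \<in> carrier S" "t \<otimes>\<^bsub>S\<^esub> u = \<one>\<^bsub>S\<^esub>"
    using right_inverse_one_plus_double[OF U lf, of "\<ominus>\<^bsub>S\<^esub> m"] m teq by auto
  have "u = ?y" using S.inv_unique[OF t(2) u(2) t(1) y u(1)] by simp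
  then show ?thesis using t u y unfolding Units_def by auto
qed

text \<open>The counterpart of \<open>flag\<close> in S, read modulo 2S: w belongs to stage i when
  every product of i factors h - 1 with h in \<open>H\<close>, applied from the left, sends w into
  2S.\<close>

primrec rad_chain :: "'g set \<Rightarrow> nat \<Rightarrow> ('g \<Rightarrow> 'a) set" where
  "rad_chain H 0 = {w \<oplus>\<^bsub>S\<^esub> w | w. w \<in> carrier S}"
| "rad_chain H (Suc i) = {w \<in> carrier S. \<forall>h\<in>H. mon \<one> h \<otimes>\<^bsub>S\<^esub> w \<ominus>\<^bsub>S\<^esub> w \<in> rad_chain H i}"

lemma rad_chain_closed: "w \<in> rad_chain H i \<Longrightarrow> w \<in> carrier S"
  by (cases i) auto

lemma rad_chain_add:
  "v \<in> rad_chain H i \<Longrightarrow> w \<in> rad_chain H i \<Longrightarrow> v \<oplus>\<^bsub>S\<^esub> w \<in> rad_chain H i"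
proof (induction i arbitrary: v w)
  case 0
  then obtain a b where "a \<in> carrier S" "b \<in> carrier S" "v = a \<oplus>\<^bsub>S\<^esub> a" "w = b \<oplus>\<^bsub>S\<^esub> b" by auto
  then have "v \<oplus>\<^bsub>S\<^esub> w = (a \<oplus>\<^bsub>S\<^esub> b) \<oplus>\<^bsub>S\<^esub> (a \<oplus>\<^bsub>S\<^esub> b)" "a \<oplus>\<^bsub>S\<^esub> b \<in> carrier S" by (simp_all add: S.a_ac)
  then show ?case by auto
next
  case (Suc i)
  have vw: "v \<in> carrier S" "w \<in> carrier S" using Suc.prems by simp_all
  have "mon \<one> h \<otimes>\<^bsub>S\<^esub> (v \<oplus>\<^bsub>S\<^esub> w) \<ominus>\<^bsub>S\<^esub> (v \<oplus>\<^bsub>S\<^esub> w) \<in> rad_chain H i" if h: "h \<in> H" for h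
  proof -
    define p q where "p = mon \<one> h \<otimes>\<^bsub>S\<^esub> v" and "q = mon \<one> h \<otimes>\<^bsub>S\<^esub> w"
    have pq: "p \<in> carrier S" "q \<in> carrier S" using vw by (simp_all add: p_def q_def)
    have "(p \<ominus>\<^bsub>S\<^esub> v) \<oplus>\<^bsub>S\<^esub> (q \<ominus>\<^bsub>S\<^esub> w) \<in> rad_chain H i"
      using Suc h by (intro Suc.IH) (simp_all add: p_def q_def)
    also have "(p \<ominus>\<^bsub>S\<^esub> v) \<oplus>\<^bsub>S\<^esub> (q \<ominus>\<^bsub>S\<^esub> w) = (p \<oplus>\<^bsub>S\<^esub> q) \<ominus>\<^bsub>S\<^esub> (v \<oplus>\<^bsub>S\<^esub> w)"
      using pq vw by algebra
    also have "p \<oplus>\<^bsub>S\<^esub> q = mon \<one> h \<otimes>\<^bsub>S\<^esub> (v \<oplus>\<^bsub>S\<^esub> w)" using vw by (simp add: p_def q_def S.r_distr)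
    finally show ?thesis .
  qed
  then show ?case using vw by simp
qed

lemma rad_chain_double: "w \<in> carrier S \<Longrightarrow> w \<oplus>\<^bsub>S\<^esub> w \<in> rad_chain H i"
proof (induction i arbitrary: w)
  case (Suc i)
  have "mon \<one> h \<otimes>\<^bsub>S\<^esub> (w \<oplus>\<^bsub>S\<^esub> w) \<ominus>\<^bsub>S\<^esub> (w \<oplus>\<^bsub>S\<^esub> w) \<in> rad_chain H i" for h
  proof -
    define p where "p = mon \<one> h \<otimes>\<^bsub>S\<^esub> w"
    have p: "p \<in> carrier S" using Suc.prems by (simp add: p_def)
    have "(p \<ominus>\<^bsub>S\<^esub> w) \<oplus>\<^bsub>S\<^esub> (p \<ominus>\<^bsub>S\<^esub> w) \<in> rad_chain H i"
      using Suc p by (intro Suc.IH) simp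
    also have "(p \<ominus>\<^bsub>S\<^esub> w) \<oplus>\<^bsub>S\<^esub> (p \<ominus>\<^bsub>S\<^esub> w) = (p \<oplus>\<^bsub>S\<^esub> p) \<ominus>\<^bsub>S\<^esub> (w \<oplus>\<^bsub>S\<^esub> w)"
      using p Suc.prems by algebra
    also have "p \<oplus>\<^bsub>S\<^esub> p = mon \<one> h \<otimes>\<^bsub>S\<^esub> (w \<oplus>\<^bsub>S\<^esub> w)" using Suc.prems by (simp add: p_def S.r_distr)
    finally show ?thesis .
  qed
  then show ?case using Suc.prems by simp
qed auto

lemma rad_chain_zero: "\<zero>\<^bsub>S\<^esub> \<in> rad_chain H i"
  using rad_chain_double[of "\<zero>\<^bsub>S\<^esub>" H i] by simp

text \<open>Coefficients commute with group elements even when they do not commute with each other,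
  so a scalar on the left passes through h - 1.\<close>

lemma rad_chain_scale:
  assumes "H \<subseteq> carrier G" "r \<in> carrier R"
  shows "w \<in> rad_chain H i \<Longrightarrow> mon r \<one>\<^bsub>G\<^esub> \<otimes>\<^bsub>S\<^esub> w \<in> rad_chain H i"
proof (induction i arbitrary: w)
  case 0
  then obtain a where "a \<in> carrier S" "w = a \<oplus>\<^bsub>S\<^esub> a" by auto
  then have "mon r \<one>\<^bsub>G\<^esub> \<otimes>\<^bsub>S\<^esub> w = mon r \<one>\<^bsub>G\<^esub> \<otimes>\<^bsub>S\<^esub> a \<oplus>\<^bsub>S\<^esub> mon r \<one>\<^bsub>G\<^esub> \<otimes>\<^bsub>S\<^esub> a"
    "mon r \<one>\<^bsub>G\<^esub> \<otimes>\<^bsub>S\<^esub> a \<in> carrier S" using assms by (simp_all add: S.r_distr)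
  then show ?case by auto
next
  case (Suc i)
  have w: "w \<in> carrier S" using Suc.prems by simp
  let ?r = "mon r \<one>\<^bsub>G\<^esub>"
  have r: "?r \<in> carrier S" using assms by simp
  have "mon \<one> h \<otimes>\<^bsub>S\<^esub> (?r \<otimes>\<^bsub>S\<^esub> w) \<ominus>\<^bsub>S\<^esub> ?r \<otimes>\<^bsub>S\<^esub> w \<in> rad_chain H i" if h: "h \<in> H" for h
  proof -
    have hG: "h \<in> carrier G" using h assms by blast
    have "?r \<otimes>\<^bsub>S\<^esub> (mon \<one> h \<otimes>\<^bsub>S\<^esub> w \<ominus>\<^bsub>S\<^esub> w) \<in> rad_chain H i"
      using Suc h by (intro Suc.IH) simp
    also have "?r \<otimes>\<^bsub>S\<^esub> (mon \<one> h \<otimes>\<^bsub>S\<^esub> w \<ominus>\<^bsub>S\<^esub> w) = ?r \<otimes>\<^bsub>S\<^esub> (mon \<one> h \<otimes>\<^bsub>S\<^esub> w) \<ominus>\<^bsub>S\<^esub> ?r \<otimes>\<^bsub>S\<^esub> w"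
      using r w by (simp add: S.minus_eq S.r_distr S.r_minus)
    also have "?r \<otimes>\<^bsub>S\<^esub> (mon \<one> h \<otimes>\<^bsub>S\<^esub> w) = mon \<one> h \<otimes>\<^bsub>S\<^esub> (?r \<otimes>\<^bsub>S\<^esub> w)"
      using r w hG assms by (simp add: mon_mult_mon flip: S.m_assoc)
    finally show ?thesis .
  qed
  then show ?case using r w by simp
qed

text \<open>The difference is the sum of r_t (t - 1)w over the coefficients r_t of \<open>f\<close>,
  and each (t - 1)w lies one stage lower by definition. So an element of augmentation zero supported
  on \<open>H\<close> lowers the stage by one.\<close>

lemma rad_chain_aug:
  assumes H: "H \<subseteq> carrier G" and w: "w \<in> rad_chain H (Suc i)" and A: "finite A" "A \<subseteq> H"
  shows "f \<in> carrier S \<Longrightarrow> supp f \<subseteq> A \<Longrightarrow> f \<otimes>\<^bsub>S\<^esub> w \<ominus>\<^bsub>S\<^esub> mon (aug f) \<one>\<^bsub>G\<^esub> \<otimes>\<^bsub>S\<^esub> w \<in> rad_chain H i"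
  using A
proof (induction A arbitrary: f rule: finite_induct)
  have wS: "w \<in> carrier S" using w by simp
  {
    case empty
    then have "f = \<zero>\<^bsub>S\<^esub>" "aug f = \<zero>" by (simp_all add: supp_empty aug_def)
    then show ?case using wS by (simp add: mon_zero rad_chain_zero S.r_neg S.minus_eq)
  next
    case (insert t A)
    have t: "t \<in> H" "t \<in> carrier G" using insert.prems H by auto
    obtain f' where f': "f' \<in> carrier S" "supp f' \<subseteq> supp f - {t}" "f = f' \<oplus>\<^bsub>S\<^esub> mon (f t) t"
      using split_coeff[OF insert.prems(1) t(2)] .
    define r where "r = f t"
    have r: "r \<in> carrier R" using insert.prems t by (simp add: r_def)
    let ?m = "\<lambda>c. mon c \<one>\<^bsub>G\<^esub>"
    have af: "aug f = aug f' \<oplus> r" using f' r t by (metis aug_add aug_mon mon_closed r_def)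
    have fe: "f = f' \<oplus>\<^bsub>S\<^esub> ?m r \<otimes>\<^bsub>S\<^esub> mon \<one> t" using f'(3) r t by (simp add: mon_mult_mon r_def)
    define p q u v where "p = f' \<otimes>\<^bsub>S\<^esub> w" and "q = ?m (aug f') \<otimes>\<^bsub>S\<^esub> w" and "u = ?m r \<otimes>\<^bsub>S\<^esub> (mon \<one> t \<otimes>\<^bsub>S\<^esub> w)" and "v = ?m r \<otimes>\<^bsub>S\<^esub> w"
    have c: "p \<in> carrier S" "q \<in> carrier S" "u \<in> carrier S" "v \<in> carrier S"
      using wS f' r by (simp_all add: p_def q_def u_def v_def)
    have "p \<ominus>\<^bsub>S\<^esub> q \<in> rad_chain H i"
      unfolding p_def q_def using f' insert.prems by (intro insert.IH) auto
    moreover have "u \<ominus>\<^bsub>S\<^esub> v \<in> rad_chain H i"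
    proof -
      have "?m r \<otimes>\<^bsub>S\<^esub> (mon \<one> t \<otimes>\<^bsub>S\<^esub> w \<ominus>\<^bsub>S\<^esub> w) \<in> rad_chain H i"
        using w t by (intro rad_chain_scale[OF H r]) simp
      then show ?thesis using wS r by (simp add: u_def v_def S.minus_eq S.r_distr S.r_minus)
    qed
    ultimately have "(p \<ominus>\<^bsub>S\<^esub> q) \<oplus>\<^bsub>S\<^esub> (u \<ominus>\<^bsub>S\<^esub> v) \<in> rad_chain H i" by (rule rad_chain_add)
    also have "(p \<ominus>\<^bsub>S\<^esub> q) \<oplus>\<^bsub>S\<^esub> (u \<ominus>\<^bsub>S\<^esub> v) = (p \<oplus>\<^bsub>S\<^esub> u) \<ominus>\<^bsub>S\<^esub> (q \<oplus>\<^bsub>S\<^esub> v)" using c by algebra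
    also have "p \<oplus>\<^bsub>S\<^esub> u = f \<otimes>\<^bsub>S\<^esub> w"
      unfolding fe p_def u_def using wS f'(1) r by (simp add: S.l_distr S.m_assoc)
    also have "q \<oplus>\<^bsub>S\<^esub> v = ?m (aug f) \<otimes>\<^bsub>S\<^esub> w"
      unfolding af q_def v_def using wS f'(1) r by (simp add: mon_add S.l_distr)
    finally show ?case .
  }
qed

text \<open>The lift of an element of the group algebra over two elements to coefficients 0 and 1 in
  R. It respects addition only modulo 2S.\<close>

definition ind :: "'g set \<Rightarrow> 'g \<Rightarrow> 'a" where
  "ind X = (\<lambda>x\<in>carrier G. if x \<in> X then \<one> else \<zero>)"

lemma ind_closed [simp]: "finite X \<Longrightarrow> ind X \<in> carrier S"
  unfolding ind_def by (rule S_memI[of _ X]) auto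

lemma ind_coeff [simp]: "x \<in> carrier G \<Longrightarrow> ind X x = (if x \<in> X then \<one> else \<zero>)"
  by (simp add: ind_def)

text \<open>Lifting (h - 1)X from coefficients modulo 2 to R costs an error in 2S, and every stage
  of \<open>rad_chain\<close> contains 2S.\<close>

lemma ind_flag:
  assumes H: "subgroup H G" "finite H"
  shows "X \<in> flag (G\<lparr>carrier := H\<rparr>) i \<Longrightarrow> ind X \<in> rad_chain H i"
proof (induction i arbitrary: X)
  case 0
  then have "ind X = \<zero>\<^bsub>S\<^esub>" by (intro S_ext) simp_all
  then show ?case using rad_chain_zero[of H 0] by simp
next
  case (Suc i)
  have X: "X \<subseteq> H" "finite X" "X \<subseteq> carrier G"
    using Suc.prems H subgroup.subset[OF H(1)] finite_subset by auto
  have "mon \<one> h \<otimes>\<^bsub>S\<^esub> ind X \<ominus>\<^bsub>S\<^esub> ind X \<in> rad_chain H i" if h: "h \<in> H" for h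
  proof -
    have hG: "h \<in> carrier G" using h subgroup.mem_carrier[OF H(1)] by blast
    let ?Y = "(\<lambda>x. h \<cdot> x) ` X"
    have Y: "mon \<one> h \<otimes>\<^bsub>S\<^esub> ind X = ind ?Y"
    proof (rule S_ext)
      fix x assume x: "x \<in> carrier G"
      have "inv\<^bsub>G\<^esub> h \<cdot> x \<in> X \<longleftrightarrow> x \<in> ?Y"
      proof
        assume "inv\<^bsub>G\<^esub> h \<cdot> x \<in> X"
        moreover have "x = h \<cdot> (inv\<^bsub>G\<^esub> h \<cdot> x)" using hG x by (simp flip: G.m_assoc)
        ultimately show "x \<in> ?Y" by blast
      next
        assume "x \<in> ?Y"
        then obtain z where z: "z \<in> X" "x = h \<cdot> z" by blast
        then have "inv\<^bsub>G\<^esub> h \<cdot> x = z" using hG X(3) by (auto simp flip: G.m_assoc)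
        then show "inv\<^bsub>G\<^esub> h \<cdot> x \<in> X" using z by simp
      qed
      then show "(mon \<one> h \<otimes>\<^bsub>S\<^esub> ind X) x = ind ?Y x" using x hG X(2) by simp
    qed (use X in simp_all)
    have "ind (symdiff ?Y X) \<in> rad_chain H i" using Suc h by simp
    \<comment> \<open>The error term: with Y the translate of X, the function of Y minus that of X
      is the function of their symmetric difference minus twice that of X - Y.\<close>
    moreover have "\<ominus>\<^bsub>S\<^esub> ind (X - ?Y) \<oplus>\<^bsub>S\<^esub> \<ominus>\<^bsub>S\<^esub> ind (X - ?Y) \<in> rad_chain H i"
      using X(2) by (intro rad_chain_double) simp
    ultimately have "ind (symdiff ?Y X) \<oplus>\<^bsub>S\<^esub> (\<ominus>\<^bsub>S\<^esub> ind (X - ?Y) \<oplus>\<^bsub>S\<^esub> \<ominus>\<^bsub>S\<^esub> ind (X - ?Y)) \<in> rad_chain H i"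
      by (rule rad_chain_add)
    also have "ind (symdiff ?Y X) \<oplus>\<^bsub>S\<^esub> (\<ominus>\<^bsub>S\<^esub> ind (X - ?Y) \<oplus>\<^bsub>S\<^esub> \<ominus>\<^bsub>S\<^esub> ind (X - ?Y)) = ind ?Y \<ominus>\<^bsub>S\<^esub> ind X"
    proof -
      define a b c where "a = ind (?Y - X)" and "b = ind (X - ?Y)" and "c = ind (X \<inter> ?Y)"
      have abc: "a \<in> carrier S" "b \<in> carrier S" "c \<in> carrier S" using X(2) by (simp_all add: a_def b_def c_def)
      have 1: "ind (symdiff ?Y X) = a \<oplus>\<^bsub>S\<^esub> b"
        using X(2) abc by (intro S_ext) (auto simp: a_def b_def)
      have 2: "ind ?Y = a \<oplus>\<^bsub>S\<^esub> c" "ind X = b \<oplus>\<^bsub>S\<^esub> c"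
        using X(2) abc by (intro S_ext; auto simp: a_def b_def c_def)+
      show ?thesis unfolding 1 2 b_def[symmetric] using abc by algebra
    qed
    finally show ?thesis unfolding Y .
  qed
  then show ?case using X(2) by simp
qed

section \<open>Units detected by the augmentation\<close>

lemma one_minus_Units_of_aug_zero:
  assumes U: "\<And>r. r \<in> carrier R \<Longrightarrow> \<one> \<oplus> (r \<oplus> r) \<in> Units R"
    and lf: "locally_finite_group G" and tg: "two_group G"
    and x: "x \<in> carrier S" "aug x = \<zero>"
  shows "\<one>\<^bsub>S\<^esub> \<ominus>\<^bsub>S\<^esub> x \<in> Units S"
proof -
  define H where "H = generate G (supp x)"
  have H: "subgroup H G" unfolding H_def by (rule G.generate_is_subgroup) simp
  have HG: "H \<subseteq> carrier G" using subgroup.subset[OF H] .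
  have finH: "finite H" using lf x unfolding H_def locally_finite_group_def by simp
  have xH: "supp x \<subseteq> H" unfolding H_def by (auto intro: generate.incl)
  let ?K = "G\<lparr>carrier := H\<rparr>"
  interpret K: group ?K using subgroup.subgroup_is_group[OF H G.is_group] .
  have "\<exists>n. g [^]\<^bsub>?K\<^esub> (2 ^ n :: nat) = \<one>\<^bsub>?K\<^esub>" if "g \<in> carrier ?K" for g
  proof -
    have g: "g \<in> carrier G" using that HG by auto
    then obtain n where "G.ord g = 2 ^ n" using tg unfolding two_group_def by blast
    then have "g [^]\<^bsub>G\<^esub> (2 ^ n :: nat) = \<one>\<^bsub>G\<^esub>" using G.pow_ord_eq_1[OF g] by simp
    then show ?thesis by (auto simp flip: G.nat_pow_consistent)
  qed
  then obtain k where "order ?K = 2 ^ k" using K.finite_two_group_order finH by auto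
  then obtain n where n: "flag ?K n = Pow H" using K.flag_exhausts finH by auto
  \<comment> \<open>The last stage is everything, so it contains the identity element; hence 1 lies
    in stage n of \<open>rad_chain\<close>.\<close>
  have "{\<one>\<^bsub>G\<^esub>} \<in> flag ?K n" using n subgroup.one_closed[OF H] by simp
  then have "ind {\<one>\<^bsub>G\<^esub>} \<in> rad_chain H n" by (rule ind_flag[OF H finH])
  also have "ind {\<one>\<^bsub>G\<^esub>} = \<one>\<^bsub>S\<^esub>" by (rule S_ext) (simp_all add: one_eq_mon)
  finally have one: "\<one>\<^bsub>S\<^esub> \<in> rad_chain H n" .
  \<comment> \<open>Each factor x has augmentation zero and descends one stage; m factors lead from
    stage m to 2S. Taken at w = 1 this puts x^n into 2S.\<close>
  have down: "w \<in> rad_chain H m \<Longrightarrow> x [^]\<^bsub>S\<^esub> m \<otimes>\<^bsub>S\<^esub> w \<in> rad_chain H 0" for m w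
  proof (induction m arbitrary: w)
    case 0
    then show ?case using rad_chain_closed[OF 0] by simp
  next
    case (Suc m)
    have w: "w \<in> carrier S" using Suc.prems by simp
    have "x \<otimes>\<^bsub>S\<^esub> w \<ominus>\<^bsub>S\<^esub> mon (aug x) \<one>\<^bsub>G\<^esub> \<otimes>\<^bsub>S\<^esub> w \<in> rad_chain H m"
      by (rule rad_chain_aug[OF HG Suc.prems finH order_refl x(1) xH])
    then have "x \<otimes>\<^bsub>S\<^esub> w \<in> rad_chain H m" using x w by (simp add: mon_zero S.minus_eq)
    then have "x [^]\<^bsub>S\<^esub> m \<otimes>\<^bsub>S\<^esub> (x \<otimes>\<^bsub>S\<^esub> w) \<in> rad_chain H 0" by (rule Suc.IH)
    then show ?case using x(1) w by (simp add: S.m_assoc)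
  qed
  obtain c where c: "c \<in> carrier S" "x [^]\<^bsub>S\<^esub> n = c \<oplus>\<^bsub>S\<^esub> c"
    using down[OF one] x(1) by auto
  \<comment> \<open>The extra factor raises the exponent from n to 2^n, the form required by
    \<open>Units_one_minus_pow2\<close>; this is possible as n is at most 2^n.\<close>
  define d where "d = x [^]\<^bsub>S\<^esub> (2 ^ n - n) \<otimes>\<^bsub>S\<^esub> c"
  have d: "d \<in> carrier S" using c x by (simp add: d_def)
  have "n \<le> 2 ^ n" by (simp add: less_imp_le)
  then have "x [^]\<^bsub>S\<^esub> (2 ^ n :: nat) = x [^]\<^bsub>S\<^esub> (2 ^ n - n) \<otimes>\<^bsub>S\<^esub> x [^]\<^bsub>S\<^esub> n"
    using x(1) by (simp add: S.nat_pow_mult)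
  also have "\<dots> = d \<oplus>\<^bsub>S\<^esub> d" using c x(1) by (simp add: d_def S.r_distr)
  finally have pow: "x [^]\<^bsub>S\<^esub> (2 ^ n :: nat) = d \<oplus>\<^bsub>S\<^esub> d" .
  have "\<one>\<^bsub>S\<^esub> \<oplus>\<^bsub>S\<^esub> (\<ominus>\<^bsub>S\<^esub> d \<oplus>\<^bsub>S\<^esub> \<ominus>\<^bsub>S\<^esub> d) \<in> Units S"
    using d by (intro one_plus_double_Units_group_ring[OF U lf]) simp_all
  also have "\<one>\<^bsub>S\<^esub> \<oplus>\<^bsub>S\<^esub> (\<ominus>\<^bsub>S\<^esub> d \<oplus>\<^bsub>S\<^esub> \<ominus>\<^bsub>S\<^esub> d) = \<one>\<^bsub>S\<^esub> \<ominus>\<^bsub>S\<^esub> x [^]\<^bsub>S\<^esub> (2 ^ n :: nat)"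
    unfolding pow using d by algebra
  finally show ?thesis by (rule S.Units_one_minus_pow2[OF x(1)])
qed

text \<open>For the converse direction, dividing \<open>f\<close> by the scalar \<open>aug f\<close>
  gives an element of augmentation 1, that is, 1 minus an element of the kernel.\<close>

lemma Units_iff_aug_Units:
  assumes U: "\<And>r. r \<in> carrier R \<Longrightarrow> \<one> \<oplus> (r \<oplus> r) \<in> Units R"
    and lf: "locally_finite_group G" and tg: "two_group G"
    and f: "f \<in> carrier S"
  shows "f \<in> Units S \<longleftrightarrow> aug f \<in> Units R"
proof
  assume v: "aug f \<in> Units R"
  define v where "v = aug f"
  have vU: "v \<in> Units R" "v \<in> carrier R" "inv v \<in> carrier R" using v by (auto simp: v_def)
  define g where "g = mon (inv v) \<one>\<^bsub>G\<^esub> \<otimes>\<^bsub>S\<^esub> f"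
  have g: "g \<in> carrier S" using vU f by (simp add: g_def)
  have ag: "aug g = \<one>" using vU f by (simp add: g_def flip: v_def)
  have "aug \<one>\<^bsub>S\<^esub> = \<one>" by (simp add: one_eq_mon)
  then have "aug (\<one>\<^bsub>S\<^esub> \<ominus>\<^bsub>S\<^esub> g) = \<zero>" using g ag by (simp add: S.minus_eq R.r_neg)
  then have "\<one>\<^bsub>S\<^esub> \<ominus>\<^bsub>S\<^esub> (\<one>\<^bsub>S\<^esub> \<ominus>\<^bsub>S\<^esub> g) \<in> Units S"
    using g by (intro one_minus_Units_of_aug_zero[OF U lf tg]) simp_all
  also have "\<one>\<^bsub>S\<^esub> \<ominus>\<^bsub>S\<^esub> (\<one>\<^bsub>S\<^esub> \<ominus>\<^bsub>S\<^esub> g) = g" using g by algebra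
  finally have "mon v \<one>\<^bsub>G\<^esub> \<otimes>\<^bsub>S\<^esub> g \<in> Units S" using mon_Units[OF vU(1)] by simp
  also have "mon v \<one>\<^bsub>G\<^esub> \<otimes>\<^bsub>S\<^esub> g = f"
    using vU f by (simp add: g_def mon_mult_mon flip: S.m_assoc one_eq_mon)
  finally show "f \<in> Units S" .
qed (rule aug_Units)

lemma mon_Tr:
  assumes "e \<in> Tr R" shows "mon e \<one>\<^bsub>G\<^esub> \<in> Tr S"
  using assms by (auto simp: Tr_def numeral_3_eq_3 mon_mult_mon)

text \<open>A unit u of S has a unit of R as augmentation; adding \<open>aug f\<close> keeps it a
  unit of R, and this is reflected back to f + u.\<close>

lemma mem_Delta_of_aug:
  assumes U: "\<And>r. r \<in> carrier R \<Longrightarrow> \<one> \<oplus> (r \<oplus> r) \<in> Units R"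
    and lf: "locally_finite_group G" and tg: "two_group G"
    and f: "f \<in> carrier S" "aug f \<in> Delta R"
  shows "f \<in> Delta S"
proof -
  have "f \<oplus>\<^bsub>S\<^esub> u \<in> Units S" if u: "u \<in> Units S" for u
  proof -
    have "aug (f \<oplus>\<^bsub>S\<^esub> u) \<in> Units R"
      using f u R.Delta_Units[OF f(2) aug_Units[OF u]] by (simp add: S.Units_closed)
    then show ?thesis using f u by (simp add: Units_iff_aug_Units[OF U lf tg] S.Units_closed)
  qed
  then show ?thesis using f(1) by (simp add: Delta_def)
qed

end

theorem theorem3p12:
  fixes R :: "('a, 'b) ring_scheme" and G :: "('g, 'c) monoid_scheme"
  assumes "DT_ring R"
    and "\<one>\<^bsub>R\<^esub> \<oplus>\<^bsub>R\<^esub> \<one>\<^bsub>R\<^esub> \<in> Delta R"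
    and "group G"
    and "locally_finite_group G"
    and "two_group G"
  shows "DT_ring (group_ring R G)"
proof -
  have "ring R" using assms(1) by (simp add: DT_ring_def)
  then interpret group_ring_over R G using assms(3) by (rule group_ring_over.intro)
  have U: "\<one>\<^bsub>R\<^esub> \<oplus>\<^bsub>R\<^esub> (r \<oplus>\<^bsub>R\<^esub> r) \<in> Units R" if "r \<in> carrier R" for r
    using R.one_plus_double_Units[OF assms(1,2) that] .
  have "\<exists>e\<in>Tr S. \<exists>d\<in>Delta S. s = e \<oplus>\<^bsub>S\<^esub> d" if s: "s \<in> carrier S" for s
  proof -
    obtain e d where e: "e \<in> Tr R" and d: "d \<in> Delta R" and ed: "aug s = e \<oplus>\<^bsub>R\<^esub> d"
      using assms(1) s unfolding DT_ring_def by (meson aug_closed)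
    have c: "e \<in> carrier R" "d \<in> carrier R" using e d by (simp_all add: Tr_def Delta_def)
    let ?e = "mon e \<one>\<^bsub>G\<^esub>"
    have eS: "?e \<in> carrier S" using c by simp
    have "aug (s \<ominus>\<^bsub>S\<^esub> ?e) = (e \<oplus>\<^bsub>R\<^esub> d) \<oplus>\<^bsub>R\<^esub> \<ominus>\<^bsub>R\<^esub> e" using s c ed by (simp add: S.minus_eq)
    also have "\<dots> = d" using c by algebra
    finally have "s \<ominus>\<^bsub>S\<^esub> ?e \<in> Delta S"
      using mem_Delta_of_aug[OF U assms(4,5)] s eS d by simp
    moreover have "s = ?e \<oplus>\<^bsub>S\<^esub> (s \<ominus>\<^bsub>S\<^esub> ?e)" using s eS by algebra
    ultimately show ?thesis using mon_Tr[OF e] by blast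
  qed
  then show ?thesis using S_ring by (simp add: DT_ring_def)
qed

end
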